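(* Let $d\geqslant 3$ and let $\ell$ be a prime power. The Hermitean forms graph $\mathrm{Her}(d,\ell)$ (with its standard $Q$-polynomial ordering) has no nontrivial descendent.
   Context: All graphs are finite, simple and undirected. Let $\Gamma$ be a connected graph with vertex set $X$, path-length distance $\partial$ and diameter $d$; let $A_i\in\mathbb{C}^{X\times X}$ be the adjacency matrix of the distance-$i$ graph ($A_0=I$). $\Gamma$ is distance-regular if there are integers $b_i,c_i$ such that whenever $\partial(x,y)=i$, $y$ has exactly $b_i$ (resp. $c_i$) neighbours at distance $i+1$ (resp. $i-1$) from $x$. Then the Bose--Mesner algebra $\langle A_0,\dots,A_d\rangle$ (complex span) is a commutative semisimple algebra with a basis of primitive idempotents $E_0=|X|^{-1}J,E_1,\dots,E_d$. $\Gamma$ is $Q$-polynomial with respect to the ordering $\{E_i\}_{i=0}^d$ if there are scalars $a_i^*,b_i^*,c_i^*$ with $b_d^*=c_0^*=0$, $b_{i-1}^*c_i^*\neq 0$ $(1\leqslant i\leqslant d)$ and $E_1\circ E_i=|X|^{-1}(b_{i-1}^*E_{i-1}+a_i^*E_i+c_{i+1}^*E_{i+1})$ $(0\leqslant i\leqslant d)$, where $\circ$ is the entrywise product, $E_{-1}=E_{d+1}=0$, $b_{-1}^*=c_{d+1}^*=0$. Write $|X|E_1=\sum_{i=0}^d\theta_i^*A_i$. For a nonempty $Y\subseteq X$ with characteristic vector $\hat Y$, the width is $w=\max\{i:\hat Y^{\mathsf T}A_i\hat Y\neq 0\}$ and the dual width is $w^*=\max\{i:\hat Y^{\mathsf T}E_i\hat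 Y\neq 0\}$. One always has $w+w^*\geqslant d$; $Y$ is a descendent of $\Gamma$ if $w+w^*=d$; it is trivial if moreover $w=0$ or $w=d$ (a singleton or $X$), nontrivial otherwise. Put $[i]_q=1+q+\dots+q^{i-1}$. $\Gamma$ has classical parameters $(d,q,\alpha,\beta)$ if $b_i=([d]_q-[i]_q)(\beta-\alpha[i]_q)$ and $c_i=[i]_q(1+\alpha[i-1]_q)$ for $0\leqslant i\leqslant d$. Then $\Gamma$ has a $Q$-polynomial ordering, called standard, for which $\theta_i^*=\xi^*[d-i]_q+\zeta^*$ for some scalars $\xi^*\neq 0$, $\zeta^*$. Let $\Delta$ be the dual polar graph on $[{}^2\!A_{2d-1}(\ell)]$, i.e. the graph whose vertices are the maximal isotropic subspaces (dimension $d$) of $\mathbb{F}_{\ell^2}^{2d}$ with a nondegenerate Hermitean form, adjacent when their intersection has dimension $d-1$. Fix a vertex $z$ of $\Delta$. $\mathrm{Her}(d,\ell)$ is the subgraph of $\Delta$ induced on the set $\Delta_d(z)$ of vertices at distance $d$ from $z$ (i.e. meeting $z$ trivially). It is distance-regular with diameter $d$ and classical parameters $(d,-\ell,-\ell-1,-(-\ell)^d-1)$. *)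

theory Defs
  imports "HOL-Analysis.Analysis" "HOL-Number_Theory.Prime_Powers"
begin

section \<open>Graphs\<close>

text \<open>A graph is a pair of a vertex set and a symmetric irreflexive adjacency relation on it.\<close>

type_synonym 'v graph = "'v set \<times> ('v \<times> 'v) set"

abbreviation verts :: "'v graph \<Rightarrow> 'v set" where
  "verts \<Gamma> \<equiv> fst \<Gamma>"

abbreviation edges :: "'v graph \<Rightarrow> ('v \<times> 'v) set" where
  "edges \<Gamma> \<equiv> snd \<Gamma>"

definition induced_subgraph :: "'v graph \<Rightarrow> 'v set \<Rightarrow> 'v graph" where
  "induced_subgraph \<Gamma> S = (verts \<Gamma> \<inter> S, edges \<Gamma> \<inter> S \<times> S)"

text \<open>The distance is only meaningful between vertices joined by a walk; all graphs it is
  applied to below are connected.\<close>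

definition gdist :: "'v graph \<Rightarrow> 'v \<Rightarrow> 'v \<Rightarrow> nat" where
  "gdist \<Gamma> x y = (LEAST n. (x, y) \<in> edges \<Gamma> ^^ n)"

definition gdiam :: "'v graph \<Rightarrow> nat" where
  "gdiam \<Gamma> = Max {gdist \<Gamma> x y | x y. x \<in> verts \<Gamma> \<and> y \<in> verts \<Gamma>}"

section \<open>The Bose--Mesner algebra and Q-polynomial orderings\<close>

text \<open>A complex matrix with rows and columns indexed by a finite set \<open>X\<close> is a function of two
  arguments that vanishes outside \<open>X \<times> X\<close>, so that equality of matrices is equality of functions.\<close>

type_synonym 'v cmatrix = "'v \<Rightarrow> 'v \<Rightarrow> complex"

definition mat_prod :: "'v set \<Rightarrow> 'v cmatrix \<Rightarrow> 'v cmatrix \<Rightarrow> 'v cmatrix" where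
  "mat_prod X M N = (\<lambda>x y. \<Sum>z\<in>X. M x z * N z y)"

definition dist_matrix :: "'v graph \<Rightarrow> nat \<Rightarrow> 'v cmatrix" where
  "dist_matrix \<Gamma> i =
     (\<lambda>x y. if x \<in> verts \<Gamma> \<and> y \<in> verts \<Gamma> \<and> gdist \<Gamma> x y = i then 1 else 0)"

definition all_ones_matrix :: "'v set \<Rightarrow> 'v cmatrix" where
  "all_ones_matrix X = (\<lambda>x y. if x \<in> X \<and> y \<in> X then 1 else 0)"

definition bose_mesner :: "'v graph \<Rightarrow> 'v cmatrix set" where
  "bose_mesner \<Gamma> =
     {M. \<exists>c :: nat \<Rightarrow> complex. M = (\<lambda>x y. \<Sum>i\<le>gdiam \<Gamma>. c i * dist_matrix \<Gamma> i x y)}"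

definition primitive_idempotent :: "'v graph \<Rightarrow> 'v cmatrix \<Rightarrow> bool" where
  "primitive_idempotent \<Gamma> E \<longleftrightarrow>
     E \<in> bose_mesner \<Gamma> \<and> E \<noteq> (\<lambda>x y. 0) \<and> mat_prod (verts \<Gamma>) E E = E \<and>
     (\<forall>F\<in>bose_mesner \<Gamma>. \<forall>G\<in>bose_mesner \<Gamma>.
        mat_prod (verts \<Gamma>) F F = F \<and> mat_prod (verts \<Gamma>) G G = G \<and>
        mat_prod (verts \<Gamma>) F G = (\<lambda>x y. 0) \<and> mat_prod (verts \<Gamma>) G F = (\<lambda>x y. 0) \<and>
        E = (\<lambda>x y. F x y + G x y) \<longrightarrow> F = (\<lambda>x y. 0) \<or> G = (\<lambda>x y. 0))"

definition idempotent_ordering :: "'v graph \<Rightarrow> (nat \<Rightarrow> 'v cmatrix) \<Rightarrow> bool" where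
  "idempotent_ordering \<Gamma> E \<longleftrightarrow>
     bij_betw E {..gdiam \<Gamma>} {F. primitive_idempotent \<Gamma> F} \<and>
     E 0 = (\<lambda>x y. all_ones_matrix (verts \<Gamma>) x y / of_nat (card (verts \<Gamma>)))"

text \<open>The two conditionals implement \<open>E\<^sub>-\<^sub>1 = E\<^sub>d\<^sub>+\<^sub>1 = 0\<close>.\<close>

definition Q_polynomial :: "'v graph \<Rightarrow> (nat \<Rightarrow> 'v cmatrix) \<Rightarrow> bool" where
  "Q_polynomial \<Gamma> E \<longleftrightarrow>
     idempotent_ordering \<Gamma> E \<and>
     (\<exists>as bs cs :: nat \<Rightarrow> complex.
        bs (gdiam \<Gamma>) = 0 \<and> cs 0 = 0 \<and>
        (\<forall>i\<in>{1..gdiam \<Gamma>}. bs (i - 1) * cs i \<noteq> 0) \<and>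
        (\<forall>i\<le>gdiam \<Gamma>.
           (\<lambda>x y. E 1 x y * E i x y) =
           (\<lambda>x y. ((if i = 0 then 0 else bs (i - 1) * E (i - 1) x y)
                   + as i * E i x y
                   + (if i = gdiam \<Gamma> then 0 else cs (i + 1) * E (i + 1) x y))
                  / of_nat (card (verts \<Gamma>)))))"

definition q_int :: "complex \<Rightarrow> nat \<Rightarrow> complex" where
  "q_int q i = (\<Sum>j<i. q ^ j)"

text \<open>The standard ordering of a graph having classical parameters with base \<open>q\<close>. That the graph
  has classical parameters (in particular is distance-regular) is not made part of the predicate.\<close>

definition standard_Q_ordering :: "'v graph \<Rightarrow> complex \<Rightarrow> (nat \<Rightarrow> 'v cmatrix) \<Rightarrow> bool" where
  "standard_Q_ordering \<Gamma> q E \<longleftrightarrow>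
     Q_polynomial \<Gamma> E \<and>
     (\<exists>(\<theta> :: nat \<Rightarrow> complex) \<xi> \<zeta>.
        (\<lambda>x y. of_nat (card (verts \<Gamma>)) * E 1 x y) =
        (\<lambda>x y. \<Sum>i\<le>gdiam \<Gamma>. \<theta> i * dist_matrix \<Gamma> i x y) \<and>
        \<xi> \<noteq> 0 \<and> (\<forall>i\<le>gdiam \<Gamma>. \<theta> i = \<xi> * q_int q (gdiam \<Gamma> - i) + \<zeta>))"

section \<open>Width, dual width and descendents\<close>

definition char_vec :: "'v set \<Rightarrow> 'v \<Rightarrow> complex" where
  "char_vec Y x = (if x \<in> Y then 1 else 0)"

definition quad_form :: "'v set \<Rightarrow> 'v cmatrix \<Rightarrow> ('v \<Rightarrow> complex) \<Rightarrow> complex" where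
  "quad_form X M v = (\<Sum>x\<in>X. \<Sum>y\<in>X. v x * M x y * v y)"

definition width :: "'v graph \<Rightarrow> 'v set \<Rightarrow> nat" where
  "width \<Gamma> Y =
     Max {i. i \<le> gdiam \<Gamma> \<and> quad_form (verts \<Gamma>) (dist_matrix \<Gamma> i) (char_vec Y) \<noteq> 0}"

definition dual_width :: "'v graph \<Rightarrow> (nat \<Rightarrow> 'v cmatrix) \<Rightarrow> 'v set \<Rightarrow> nat" where
  "dual_width \<Gamma> E Y =
     Max {i. i \<le> gdiam \<Gamma> \<and> quad_form (verts \<Gamma>) (E i) (char_vec Y) \<noteq> 0}"

definition descendent :: "'v graph \<Rightarrow> (nat \<Rightarrow> 'v cmatrix) \<Rightarrow> 'v set \<Rightarrow> bool" where
  "descendent \<Gamma> E Y \<longleftrightarrow>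
     Y \<noteq> {} \<and> Y \<subseteq> verts \<Gamma> \<and> width \<Gamma> Y + dual_width \<Gamma> E Y = gdiam \<Gamma>"

definition nontrivial_descendent :: "'v graph \<Rightarrow> (nat \<Rightarrow> 'v cmatrix) \<Rightarrow> 'v set \<Rightarrow> bool" where
  "nontrivial_descendent \<Gamma> E Y \<longleftrightarrow>
     descendent \<Gamma> E Y \<and> \<not> (width \<Gamma> Y = 0 \<or> width \<Gamma> Y = gdiam \<Gamma>)"

section \<open>Dual polar graphs of Hermitean type and Hermitean forms graphs\<close>

text \<open>Over a field with \<open>\<ell>\<^sup>2\<close> elements, \<open>x \<mapsto> x ^ \<ell>\<close> is the automorphism of order two. Semilinearity in
  the second argument follows from the last clause.\<close>

definition hermitean_form :: "nat \<Rightarrow> (('a::field)^'n \<Rightarrow> 'a^'n \<Rightarrow> 'a) \<Rightarrow> bool" where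
  "hermitean_form l h \<longleftrightarrow>
     (\<forall>x y z. h (x + y) z = h x z + h y z) \<and>
     (\<forall>c x y. h (c *s x) y = c * h x y) \<and>
     (\<forall>x y. h y x = h x y ^ l)"

definition nondegenerate :: "(('a::field)^'n \<Rightarrow> 'a^'n \<Rightarrow> 'a) \<Rightarrow> bool" where
  "nondegenerate h \<longleftrightarrow> (\<forall>x. (\<forall>y. h x y = 0) \<longrightarrow> x = 0)"

definition isotropic_subspace :: "(('a::field)^'n \<Rightarrow> 'a^'n \<Rightarrow> 'a) \<Rightarrow> ('a^'n) set \<Rightarrow> bool" where
  "isotropic_subspace h U \<longleftrightarrow> vec.subspace U \<and> (\<forall>x\<in>U. \<forall>y\<in>U. h x y = 0)"

definition maximal_isotropic :: "(('a::field)^'n \<Rightarrow> 'a^'n \<Rightarrow> 'a) \<Rightarrow> ('a^'n) set \<Rightarrow> bool" where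
  "maximal_isotropic h U \<longleftrightarrow>
     isotropic_subspace h U \<and> (\<forall>W. isotropic_subspace h W \<and> U \<subseteq> W \<longrightarrow> W = U)"

text \<open>For a nondegenerate Hermitean form on a space of dimension \<open>2d\<close> over a finite field the
  maximal isotropic subspaces are exactly the isotropic subspaces of dimension \<open>d\<close>.\<close>

definition dual_polar_graph :: "nat \<Rightarrow> (('a::field)^'n \<Rightarrow> 'a^'n \<Rightarrow> 'a) \<Rightarrow> ('a^'n) set graph" where
  "dual_polar_graph d h =
     ({U. maximal_isotropic h U \<and> vec.dim U = d},
      {(U, W). maximal_isotropic h U \<and> vec.dim U = d \<and> maximal_isotropic h W \<and> vec.dim W = d \<and>
               vec.dim (U \<inter> W) = d - 1})"

definition hermitean_forms_graph ::
    "nat \<Rightarrow> (('a::field)^'n \<Rightarrow> 'a^'n \<Rightarrow> 'a) \<Rightarrow> ('a^'n) set \<Rightarrow> ('a^'n) set graph" where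
  "hermitean_forms_graph d h z =
     induced_subgraph (dual_polar_graph d h)
       {U \<in> verts (dual_polar_graph d h). gdist (dual_polar_graph d h) z U = d}"

end

theory Submission
  imports Defs "HOL-Number_Theory.Residues"
begin

text \<open>Let \<open>\<Gamma>\<close> be distance-regular of diameter \<open>D\<close> with a standard ordering for the base \<open>q = -l\<close>, and
  let \<open>Y\<close> have width \<open>0 < w < D\<close> and dual width \<open>D - w\<close>. For every vertex \<open>x\<close>, the number of elements of \<open>Y\<close>
  at distance \<open>j\<close> from \<open>x\<close>, divided by the \<open>j\<close>-th valency, is \<open>F(\<theta>\<^sub>j)\<close> for a polynomial \<open>F\<close> of degree at
  most \<open>D - w\<close> in the dual eigenvalues. If \<open>x \<in> Y\<close>, then \<open>F\<close> vanishes at \<open>\<theta>\<^sub>j\<close> for \<open>j > w\<close>, which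
  determines it up to a factor, and \<open>F(\<theta>\<^sub>1) / F(\<theta>\<^sub>0) = [w]\<^sub>q / [D]\<^sub>q\<close>. If \<open>x\<close> is at distance one from
  \<open>Y\<close>, then \<open>F\<close> vanishes at \<open>\<theta>\<^sub>0\<close> and at \<open>\<theta>\<^sub>j\<close> for \<open>j > w + 1\<close>, and
  \<open>F(\<theta>\<^sub>2) / F(\<theta>\<^sub>1)\<close> is a positive multiple of \<open>[w]\<^sub>q / [D - 1]\<^sub>q\<close>. Both ratios are nonnegative, but the
  sign of \<open>[i]\<^sub>q\<close> alternates with \<open>i\<close>, so \<open>w\<close> would have the parity of \<open>D\<close> and of \<open>D - 1\<close>.

  That the Hermitean forms graph is distance-regular follows from Witt-type transitivity: the
  isometries fixing \<open>z\<close> act transitively on the pairs of vertices at a given distance, because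
  Hermitean forms of equal rank over a finite field are congruent.\<close>

section \<open>Distance-regular graphs\<close>

text \<open>All intersection numbers are postulated, not only the \<open>b_i\<close> and
  \<open>c_i\<close>: this is what transitivity on pairs at a given distance provides, and it makes
  the span of the distance matrices closed under multiplication.\<close>

locale distance_regular =
  fixes \<Gamma> :: "'v graph" and p :: "nat \<Rightarrow> nat \<Rightarrow> nat \<Rightarrow> nat"
  assumes finite_verts: "finite (verts \<Gamma>)"
    and edges_subset: "edges \<Gamma> \<subseteq> verts \<Gamma> \<times> verts \<Gamma>"
    and sym_edges: "sym (edges \<Gamma>)"
    and connected: "\<lbrakk>x \<in> verts \<Gamma>; y \<in> verts \<Gamma>\<rbrakk> \<Longrightarrow> \<exists>n. (x, y) \<in> edges \<Gamma> ^^ n"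
    and intersection_number: "\<lbrakk>x \<in> verts \<Gamma>; y \<in> verts \<Gamma>\<rbrakk> \<Longrightarrow>
      card {v \<in> verts \<Gamma>. gdist \<Gamma> x v = i \<and> gdist \<Gamma> v y = j} = p i j (gdist \<Gamma> x y)"
begin

abbreviation "X \<equiv> verts \<Gamma>"
abbreviation "D \<equiv> gdiam \<Gamma>"

lemma gdist_walk: "\<lbrakk>x \<in> X; y \<in> X\<rbrakk> \<Longrightarrow> (x, y) \<in> edges \<Gamma> ^^ gdist \<Gamma> x y"
  unfolding gdist_def by (rule LeastI_ex) (rule connected)

lemma gdist_le: "(x, y) \<in> edges \<Gamma> ^^ n \<Longrightarrow> gdist \<Gamma> x y \<le> n"
  unfolding gdist_def by (rule Least_le)

lemma gdist_self [simp]: "gdist \<Gamma> x x = 0"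
  using gdist_le[of x x 0] by simp

lemma gdist_eq_0_iff: "\<lbrakk>x \<in> X; y \<in> X\<rbrakk> \<Longrightarrow> gdist \<Gamma> x y = 0 \<longleftrightarrow> x = y"
  using gdist_walk[of x y] by auto

lemma gdist_commute: "gdist \<Gamma> x y = gdist \<Gamma> y x"
proof -
  have "(edges \<Gamma> ^^ n)\<inverse> = edges \<Gamma> ^^ n" for n
    using sym_edges by (induction n) (simp_all add: converse_relcomp sym_conv_converse_eq relpow_commute)
  then show ?thesis
    unfolding gdist_def by (metis converse_iff)
qed

lemma gdist_triangle:
  assumes "x \<in> X" "y \<in> X" "v \<in> X"
  shows "gdist \<Gamma> x v \<le> gdist \<Gamma> x y + gdist \<Gamma> y v"
  using gdist_walk[OF assms(1,2)] gdist_walk[OF assms(2,3)]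
  by (intro gdist_le) (auto simp: relpow_add)

lemma finite_gdist_set: "finite {gdist \<Gamma> x y | x y. x \<in> X \<and> y \<in> X}"
proof -
  have "{gdist \<Gamma> x y | x y. x \<in> X \<and> y \<in> X} = (\<lambda>(x, y). gdist \<Gamma> x y) ` (X \<times> X)"
    by auto
  then show ?thesis
    using finite_verts by simp
qed

lemma gdist_le_gdiam: "\<lbrakk>x \<in> X; y \<in> X\<rbrakk> \<Longrightarrow> gdist \<Gamma> x y \<le> D"
  unfolding gdiam_def using finite_gdist_set by (intro Max_ge) auto

text \<open>Cut a shortest walk after \<open>m\<close> steps. The triangle inequality leaves no
  slack, so the cut vertex is at distance exactly \<open>m\<close>.\<close>

lemma gdist_intermediate:
  assumes "x \<in> X" "y \<in> X" "m \<le> gdist \<Gamma> x y"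
  shows "\<exists>v\<in>X. gdist \<Gamma> x v = m"
proof -
  have "(x, y) \<in> edges \<Gamma> ^^ m O edges \<Gamma> ^^ (gdist \<Gamma> x y - m)"
    using gdist_walk[OF assms(1,2)] assms(3) by (simp flip: relpow_add)
  then obtain v where v: "(x, v) \<in> edges \<Gamma> ^^ m" "(v, y) \<in> edges \<Gamma> ^^ (gdist \<Gamma> x y - m)"
    by auto
  have "v \<in> X"
  proof (cases m)
    case 0
    then show ?thesis using v assms by simp
  next
    case (Suc k)
    then obtain u where "(u, v) \<in> edges \<Gamma>"
      using v(1) by auto
    then show ?thesis
      using edges_subset by auto
  qed
  moreover from this have "gdist \<Gamma> x y \<le> gdist \<Gamma> x v + gdist \<Gamma> v y"
    using gdist_triangle assms by blast
  ultimately show ?thesis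
    using gdist_le[OF v(1)] gdist_le[OF v(2)] assms(3) by (intro bexI[of _ v]) auto
qed

text \<open>With equal endpoints both distance conditions of an intersection number
  coincide.\<close>

lemma valency: "x \<in> X \<Longrightarrow> card {v \<in> X. gdist \<Gamma> x v = j} = p j j 0"
  using intersection_number[of x x j j] by (simp add: gdist_commute[of _ x])

lemma gdist_surj:
  assumes "X \<noteq> {}" "j \<le> D"
  obtains x y where "x \<in> X" "y \<in> X" "gdist \<Gamma> x y = j"
proof -
  have "D \<in> {gdist \<Gamma> x y | x y. x \<in> X \<and> y \<in> X}"
    unfolding gdiam_def using finite_gdist_set assms by (intro Max_in) auto
  then obtain x y where "x \<in> X" "y \<in> X" "gdist \<Gamma> x y = D"
    by auto
  then show ?thesis
    using gdist_intermediate[of x y j] assms that by auto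
qed

lemma valency_pos:
  assumes "X \<noteq> {}" "j \<le> D"
  shows "p j j 0 > 0"
proof -
  obtain x y where "x \<in> X" "y \<in> {v \<in> X. gdist \<Gamma> x v = j}"
    using gdist_surj[OF assms] by blast
  moreover from this have "card {v \<in> X. gdist \<Gamma> x v = j} > 0"
    using finite_verts by (subst card_gt_0_iff) auto
  ultimately show ?thesis
    using valency by simp
qed

text \<open>A walk from \<open>Y\<close> to its complement has an edge leaving \<open>Y\<close>; the
  outer end of that edge serves as \<open>x\<close>.\<close>

lemma exists_boundary_vertex:
  assumes "Y \<subseteq> X" "Y \<noteq> {}" "Y \<noteq> X"
  shows "\<exists>x\<in>X - Y. \<exists>y\<in>Y. gdist \<Gamma> x y = 1"
proof -
  obtain y v where y: "y \<in> Y" and v: "v \<in> X" "v \<notin> Y"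
    using assms by blast
  have "(y, v) \<in> (edges \<Gamma>)\<^sup>*"
    using connected[of y v] y v assms by (auto simp: rtrancl_power)
  from this v(2) have "\<exists>a b. (a, b) \<in> edges \<Gamma> \<and> a \<in> Y \<and> b \<notin> Y"
    by (induction rule: rtrancl_induct) (use y in blast)+
  then obtain a b where ab: "(a, b) \<in> edges \<Gamma>" "a \<in> Y" "b \<notin> Y"
    by blast
  then have "b \<in> X" "a \<in> X" "b \<noteq> a"
    using edges_subset by auto
  moreover have "gdist \<Gamma> a b \<le> 1"
    using gdist_le[of a b 1] ab by simp
  ultimately have "gdist \<Gamma> b a = 1"
    using gdist_eq_0_iff[of a b] by (simp add: gdist_commute[of b a])
  then show ?thesis
    using ab \<open>b \<in> X\<close> by blast
qed

subsection \<open>The Bose--Mesner algebra\<close>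

text \<open>The combination of the distance matrices with coefficients \<open>f\<close>.
  Calculations in the algebra become calculations with functions of the distance on
  \<open>{..D}\<close>.\<close>

definition bm :: "(nat \<Rightarrow> complex) \<Rightarrow> 'v cmatrix" where
  "bm f = (\<lambda>x y. if x \<in> X \<and> y \<in> X then f (gdist \<Gamma> x y) else 0)"

abbreviation mp :: "'v cmatrix \<Rightarrow> 'v cmatrix \<Rightarrow> 'v cmatrix" where
  "mp \<equiv> mat_prod X"

lemma bose_mesner_eq: "bose_mesner \<Gamma> = range bm"
proof -
  have "(\<lambda>x y. \<Sum>i\<le>D. c i * dist_matrix \<Gamma> i x y) = bm c" for c
  proof (intro ext)
    fix x y
    show "(\<Sum>i\<le>D. c i * dist_matrix \<Gamma> i x y) = bm c x y"
    proof (cases "x \<in> X \<and> y \<in> X")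
      case True
      have "(\<Sum>i\<le>D. c i * dist_matrix \<Gamma> i x y) = (\<Sum>i\<le>D. if gdist \<Gamma> x y = i then c i else 0)"
        using True by (intro sum.cong) (auto simp: dist_matrix_def)
      then show ?thesis
        using True gdist_le_gdiam by (simp add: bm_def)
    qed (auto simp: dist_matrix_def bm_def)
  qed
  then show ?thesis
    unfolding bose_mesner_def by auto
qed

lemma bm_cong: "(\<And>j. j \<le> D \<Longrightarrow> f j = g j) \<Longrightarrow> bm f = bm g"
  using gdist_le_gdiam by (auto simp: bm_def fun_eq_iff)

lemma bm_sum: "bm (\<lambda>j. \<Sum>i\<in>I. c i * f i j) = (\<lambda>x y. \<Sum>i\<in>I. c i * bm (f i) x y)"
  by (auto simp: bm_def fun_eq_iff)

lemma bm_diff: "bm (\<lambda>j. f j - g j) = (\<lambda>x y. bm f x y - bm g x y)"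
  by (auto simp: bm_def fun_eq_iff)

lemma bm_commute: "bm f x y = bm f y x"
  by (simp add: bm_def gdist_commute)

text \<open>Sort the middle vertex \<open>v\<close> by its distances to \<open>x\<close> and
  \<open>y\<close>; the number of \<open>v\<close> with distances \<open>i\<close> and
  \<open>j\<close> is an intersection number.\<close>

lemma mp_bm:
  "mp (bm f) (bm g) = bm (\<lambda>k. \<Sum>i\<le>D. \<Sum>j\<le>D. f i * g j * of_nat (p i j k))"
proof (intro ext)
  fix x y
  show "mp (bm f) (bm g) x y = bm (\<lambda>k. \<Sum>i\<le>D. \<Sum>j\<le>D. f i * g j * of_nat (p i j k)) x y"
  proof (cases "x \<in> X \<and> y \<in> X")
    case True
    have "mp (bm f) (bm g) x y = (\<Sum>v\<in>X. f (gdist \<Gamma> x v) * g (gdist \<Gamma> v y))"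
      using True by (simp add: mat_prod_def bm_def)
    also have "\<dots> = (\<Sum>v\<in>X. \<Sum>i\<le>D. \<Sum>j\<le>D.
        if gdist \<Gamma> x v = i then if gdist \<Gamma> v y = j then f i * g j else 0 else 0)"
    proof (intro sum.cong refl)
      fix v assume "v \<in> X"
      then have "gdist \<Gamma> x v \<le> D" "gdist \<Gamma> v y \<le> D"
        using True gdist_le_gdiam by auto
      moreover have "(\<Sum>j\<le>D. if gdist \<Gamma> x v = i then if gdist \<Gamma> v y = j then f i * g j else 0 else 0)
          = (if gdist \<Gamma> x v = i then \<Sum>j\<le>D. if gdist \<Gamma> v y = j then f i * g j else 0 else 0)" for i
        by simp
      ultimately show "f (gdist \<Gamma> x v) * g (gdist \<Gamma> v y) = (\<Sum>i\<le>D. \<Sum>j\<le>D.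
        if gdist \<Gamma> x v = i then if gdist \<Gamma> v y = j then f i * g j else 0 else 0)"
        by (simp add: sum.delta')
    qed
    also have "\<dots> = (\<Sum>i\<le>D. \<Sum>v\<in>X. \<Sum>j\<le>D.
        if gdist \<Gamma> x v = i then if gdist \<Gamma> v y = j then f i * g j else 0 else 0)"
      by (rule sum.swap)
    also have "\<dots> = (\<Sum>i\<le>D. \<Sum>j\<le>D. \<Sum>v\<in>X.
        if gdist \<Gamma> x v = i then if gdist \<Gamma> v y = j then f i * g j else 0 else 0)"
      by (intro sum.cong refl, rule sum.swap)
    also have "\<dots> = (\<Sum>i\<le>D. \<Sum>j\<le>D. f i * g j * of_nat (p i j (gdist \<Gamma> x y)))"
    proof (intro sum.cong refl)
      fix i j
      have "(\<Sum>v\<in>X. if gdist \<Gamma> x v = i then if gdist \<Gamma> v y = j then f i * g j else 0 else 0)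
        = (\<Sum>v\<in>X. if gdist \<Gamma> x v = i \<and> gdist \<Gamma> v y = j then f i * g j else 0)"
        by (intro sum.cong) auto
      also have "\<dots> = (\<Sum>v\<in>{v\<in>X. gdist \<Gamma> x v = i \<and> gdist \<Gamma> v y = j}. f i * g j)"
        using finite_verts by (simp only: sum.inter_filter)
      finally show "(\<Sum>v\<in>X. if gdist \<Gamma> x v = i then if gdist \<Gamma> v y = j then f i * g j else 0 else 0)
        = f i * g j * of_nat (p i j (gdist \<Gamma> x y))"
        using True by (simp add: intersection_number)
    qed
    finally show ?thesis
      using True by (simp add: bm_def)
  qed (auto simp: bm_def mat_prod_def)
qed

text \<open>Both factors and, by \<open>mp_bm\<close>, their product are symmetric, while
  transposition reverses the order of the factors.\<close>

lemma mp_bm_commute: "mp (bm f) (bm g) = mp (bm g) (bm f)"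
proof (intro ext)
  fix x y
  have "mp (bm f) (bm g) x y = mp (bm f) (bm g) y x"
    unfolding mp_bm by (rule bm_commute)
  also have "\<dots> = mp (bm g) (bm f) x y"
    unfolding mat_prod_def
    by (intro sum.cong refl) (simp add: bm_commute[of _ y] bm_commute[of _ _ x] mult.commute)
  finally show "mp (bm f) (bm g) x y = mp (bm g) (bm f) x y" .
qed

section \<open>Orthogonality of the primitive idempotents\<close>

lemma mp_assoc: "mp (mp L M) N = mp L (mp M N)"
proof (intro ext)
  fix x y
  have "mp (mp L M) N x y = (\<Sum>v\<in>X. \<Sum>u\<in>X. L x u * M u v * N v y)"
    by (simp add: mat_prod_def sum_distrib_right)
  also have "\<dots> = (\<Sum>u\<in>X. \<Sum>v\<in>X. L x u * M u v * N v y)"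
    by (rule sum.swap)
  finally show "mp (mp L M) N x y = mp L (mp M N) x y"
    by (simp add: mat_prod_def sum_distrib_left mult.assoc)
qed

lemma mp_diff_left: "mp (\<lambda>x y. L x y - M x y) N = (\<lambda>x y. mp L N x y - mp M N x y)"
  by (simp add: mat_prod_def fun_eq_iff left_diff_distrib sum_subtractf)

lemma mp_diff_right: "mp L (\<lambda>x y. M x y - N x y) = (\<lambda>x y. mp L M x y - mp L N x y)"
  by (simp add: mat_prod_def fun_eq_iff right_diff_distrib sum_subtractf)

text \<open>By commutativity the product \<open>P\<close> is an idempotent absorbed by
  \<open>E\<close> on both sides. Hence \<open>P\<close> and \<open>E - P\<close> are orthogonal
  idempotents with sum \<open>E\<close>, and primitivity of \<open>E\<close> makes one of them
  zero.\<close>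

lemma primitive_idempotent_mult:
  assumes E: "primitive_idempotent \<Gamma> E" and F: "primitive_idempotent \<Gamma> F"
  shows "mp E F = (\<lambda>x y. 0) \<or> mp E F = E"
proof -
  obtain e f where e: "E = bm e" and f: "F = bm f"
    using E F unfolding primitive_idempotent_def bose_mesner_eq by auto
  have idem: "mp E E = E" "mp F F = F"
    using E F by (auto simp: primitive_idempotent_def)
  define P where "P = mp E F"
  have P_bm: "P \<in> bose_mesner \<Gamma>"
    unfolding bose_mesner_eq P_def e f mp_bm by auto
  then obtain r where r: "P = bm r"
    by (auto simp: bose_mesner_eq)
  have G_bm: "(\<lambda>x y. E x y - P x y) \<in> bose_mesner \<Gamma>"
    unfolding bose_mesner_eq e r bm_diff[symmetric] by auto
  have EP: "mp E P = P"
    by (simp add: P_def idem flip: mp_assoc)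
  then have PE: "mp P E = P"
    using mp_bm_commute[of r e] by (simp add: e r)
  have "mp P F = P"
    by (simp add: P_def mp_assoc idem)
  then have PP: "mp P P = P"
    using PE mp_assoc[of P E F] by (simp add: P_def)
  have "P = (\<lambda>x y. 0) \<or> (\<lambda>x y. E x y - P x y) = (\<lambda>x y. 0)"
  proof -
    have "E = (\<lambda>x y. P x y + (E x y - P x y))"
      by simp
    moreover have "mp (\<lambda>x y. E x y - P x y) (\<lambda>x y. E x y - P x y) = (\<lambda>x y. E x y - P x y)"
      "mp P (\<lambda>x y. E x y - P x y) = (\<lambda>x y. 0)" "mp (\<lambda>x y. E x y - P x y) P = (\<lambda>x y. 0)"
      by (simp_all add: mp_diff_left mp_diff_right idem EP PE PP)
    ultimately show ?thesis
      using E P_bm G_bm PP unfolding primitive_idempotent_def by blast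
  qed
  then show ?thesis
    by (auto simp: P_def fun_eq_iff)
qed

text \<open>By commutativity, a nonzero product would be equal to both factors.\<close>

lemma primitive_idempotents_orthogonal:
  assumes "primitive_idempotent \<Gamma> E" "primitive_idempotent \<Gamma> F" "E \<noteq> F"
  shows "mp E F = (\<lambda>x y. 0)"
proof -
  obtain e f where "E = bm e" "F = bm f"
    using assms unfolding primitive_idempotent_def bose_mesner_eq by auto
  then have "mp E F = mp F E"
    by (simp add: mp_bm_commute)
  then show ?thesis
    using primitive_idempotent_mult[OF assms(1,2)] primitive_idempotent_mult[OF assms(2,1)] assms(3)
    by metis
qed

end

subsection \<open>Q-polynomial orderings\<close>

text \<open>\<open>e i j\<close> is the entry of \<open>E i\<close> at distance \<open>j\<close>.
  The assumption \<open>recurrence\<close> is the three-term relation for the entrywise product of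
  \<open>E 1\<close> and \<open>E i\<close>, read at distance \<open>j\<close> and multiplied by
  \<open>card X\<close>, with \<open>\<theta> j\<close> in the place of \<open>card X\<close> times
  the entry of \<open>E 1\<close>.\<close>

locale Q_polynomial_graph = distance_regular \<Gamma> p
  for \<Gamma> :: "'v graph" and p :: "nat \<Rightarrow> nat \<Rightarrow> nat \<Rightarrow> nat" +
  fixes E :: "nat \<Rightarrow> 'v cmatrix" and e :: "nat \<Rightarrow> nat \<Rightarrow> complex" and \<theta> :: "nat \<Rightarrow> complex"
    and as bs cs :: "nat \<Rightarrow> complex"
  assumes gdiam_pos: "gdiam \<Gamma> \<ge> 1"
    and nonempty: "verts \<Gamma> \<noteq> {}"
    and idempotents: "i \<le> gdiam \<Gamma> \<Longrightarrow> primitive_idempotent \<Gamma> (E i)"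
    and inj_E: "inj_on E {..gdiam \<Gamma>}"
    and E_eq: "i \<le> gdiam \<Gamma> \<Longrightarrow> E i = bm (e i)"
    and e_0: "j \<le> gdiam \<Gamma> \<Longrightarrow> e 0 j = 1 / of_nat (card (verts \<Gamma>))"
    and cs_nonzero: "i \<in> {1..gdiam \<Gamma>} \<Longrightarrow> cs i \<noteq> 0"
    and recurrence: "\<lbrakk>i \<le> gdiam \<Gamma>; j \<le> gdiam \<Gamma>\<rbrakk> \<Longrightarrow> \<theta> j * e i j =
          (if i = 0 then 0 else bs (i - 1) * e (i - 1) j) + as i * e i j
            + (if i = gdiam \<Gamma> then 0 else cs (i + 1) * e (i + 1) j)"
    and inj_\<theta>: "inj_on \<theta> {..gdiam \<Gamma>}"
begin

section \<open>Spanning of the Bose--Mesner algebra by the idempotents\<close>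

lemma card_verts_pos: "card X > 0"
  using nonempty finite_verts by (simp add: card_gt_0_iff)

text \<open>Coefficient functions of the matrices in the span of the \<open>E i\<close>. The span
  turns out to be the whole algebra: it contains the constants, which are multiples of
  \<open>e 0\<close>, and is closed under multiplication by \<open>\<theta>\<close>, so it contains
  every polynomial in \<open>\<theta>\<close>.\<close>

definition e_span :: "(nat \<Rightarrow> complex) set" where
  "e_span = {f. \<exists>c. \<forall>j\<le>D. f j = (\<Sum>i\<le>D. c i * e i j)}"

lemma e_span_sum:
  assumes "finite I" "\<And>m. m \<in> I \<Longrightarrow> f m \<in> e_span"
  shows "(\<lambda>j. \<Sum>m\<in>I. a m * f m j) \<in> e_span"
proof -
  have "\<forall>m. \<exists>c. m \<in> I \<longrightarrow> (\<forall>j\<le>D. f m j = (\<Sum>i\<le>D. c i * e i j))"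
    using assms(2) unfolding e_span_def by blast
  then obtain c where c: "\<And>m j. m \<in> I \<Longrightarrow> j \<le> D \<Longrightarrow> f m j = (\<Sum>i\<le>D. c m i * e i j)"
    by metis
  have "(\<Sum>m\<in>I. a m * f m j) = (\<Sum>i\<le>D. (\<Sum>m\<in>I. a m * c m i) * e i j)" if "j \<le> D" for j
  proof -
    have "(\<Sum>m\<in>I. a m * f m j) = (\<Sum>m\<in>I. \<Sum>i\<le>D. a m * c m i * e i j)"
      using c that by (intro sum.cong refl) (simp add: sum_distrib_left mult.assoc)
    also have "\<dots> = (\<Sum>i\<le>D. \<Sum>m\<in>I. a m * c m i * e i j)"
      by (rule sum.swap)
    finally show ?thesis
      by (simp add: sum_distrib_right)
  qed
  then show ?thesis
    unfolding e_span_def mem_Collect_eq by (intro exI[of _ "\<lambda>i. \<Sum>m\<in>I. a m * c m i"]) auto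
qed

lemma e_span_cong:
  assumes "f \<in> e_span" "\<And>j. j \<le> D \<Longrightarrow> g j = f j"
  shows "g \<in> e_span"
  using assms unfolding e_span_def by simp

lemma e_in_e_span:
  assumes "i \<le> D"
  shows "e i \<in> e_span"
proof -
  have "e i j = (\<Sum>m\<le>D. (if m = i then 1 else 0) * e m j)" for j
    using assms by (simp add: if_distrib[of "\<lambda>t. t * _"] cong: if_cong)
  then show ?thesis
    unfolding e_span_def mem_Collect_eq by (intro exI[of _ "\<lambda>m. if m = i then 1 else 0"]) blast
qed

lemma e_span_add_scaled:
  assumes "f \<in> e_span" "g \<in> e_span"
  shows "(\<lambda>j. a * f j + b * g j) \<in> e_span"
proof -
  have "(\<lambda>j. \<Sum>m\<in>{True, False}. (if m then a else b) * (if m then f else g) j) \<in> e_span"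
    using assms by (intro e_span_sum) auto
  then show ?thesis
    by simp
qed

lemma e_span_times_\<theta>:
  assumes "f \<in> e_span"
  shows "(\<lambda>j. \<theta> j * f j) \<in> e_span"
proof -
  obtain c where c: "\<And>j. j \<le> D \<Longrightarrow> f j = (\<Sum>i\<le>D. c i * e i j)"
    using assms unfolding e_span_def by blast
  have *: "(\<lambda>j. \<theta> j * e i j) \<in> e_span" if i: "i \<le> D" for i
  proof -
    \<comment> \<open>At \<open>i = 0\<close> the index \<open>i - 1\<close> truncates to
      \<open>0\<close>, and at \<open>i = D\<close> the upper index is kept at \<open>D\<close>. The
      coefficients are zero there; the indices only have to stay in range.\<close>
    have "(\<lambda>j. 1 * ((if i = 0 then 0 else bs (i - 1)) * e (i - 1) j + as i * e i j)
        + (if i = D then 0 else cs (i + 1)) * e (if i = D then i else i + 1) j) \<in> e_span"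
      using i by (intro e_span_add_scaled e_in_e_span) auto
    then show ?thesis
      by (rule e_span_cong) (use recurrence[OF i] in auto)
  qed
  have "(\<lambda>j. \<Sum>i\<le>D. c i * (\<theta> j * e i j)) \<in> e_span"
    using * by (intro e_span_sum) auto
  then show ?thesis
    by (rule e_span_cong) (simp add: c sum_distrib_left mult.left_commute)
qed

lemma e_span_prod:
  assumes "finite T"
  shows "(\<lambda>j. \<Prod>t\<in>T. \<theta> j - t) \<in> e_span"
  using assms
proof (induction T rule: finite_induct)
  case empty
  have "(\<lambda>j. of_nat (card X) * e 0 j + 0 * e 0 j) \<in> e_span"
    by (intro e_span_add_scaled e_in_e_span) auto
  then show ?case
    by (rule e_span_cong) (use e_0 card_verts_pos in auto)
next
  case (insert t T)
  have "(\<lambda>j. 1 * (\<theta> j * (\<Prod>t\<in>T. \<theta> j - t)) + (- t) * (\<Prod>t\<in>T. \<theta> j - t)) \<in> e_span"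
    by (intro e_span_add_scaled e_span_times_\<theta> insert.IH)
  then show ?case
    by (rule e_span_cong) (use insert.hyps in \<open>simp add: algebra_simps\<close>)
qed

text \<open>The dual eigenvalues are distinct, so Lagrange interpolation in them produces every function.\<close>

lemma in_e_span: "f \<in> e_span"
proof -
  define L where "L m j = (\<Prod>t\<in>\<theta> ` ({..D} - {m}). \<theta> j - t)" for m j
  have off: "L m j = 0" if "j \<le> D" "j \<noteq> m" for m j
    unfolding L_def using that by (intro prod_zero) auto
  have diag: "L m m \<noteq> 0" if "m \<le> D" for m
    unfolding L_def using inj_\<theta> that by (auto simp: inj_on_def)
  have "(\<lambda>j. \<Sum>m\<le>D. (f m / L m m) * L m j) \<in> e_span"
    unfolding L_def by (intro e_span_sum e_span_prod) auto
  then show ?thesis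
  proof (rule e_span_cong)
    fix j assume j: "j \<le> D"
    have "(\<Sum>m\<le>D. (f m / L m m) * L m j) = (\<Sum>m\<le>D. if m = j then f j else 0)"
      using off[OF j] diag[OF j] by (intro sum.cong) auto
    then show "f j = (\<Sum>m\<le>D. (f m / L m m) * L m j)"
      using j by simp
  qed
qed

section \<open>Projections of a characteristic vector\<close>

lemma idempotent: "i \<le> D \<Longrightarrow> mp (E i) (E i) = E i"
  using idempotents unfolding primitive_idempotent_def by blast

lemma orthogonal: "\<lbrakk>i \<le> D; j \<le> D; i \<noteq> j\<rbrakk> \<Longrightarrow> mp (E i) (E j) = (\<lambda>x y. 0)"
  using inj_onD[OF inj_E, of i j] by (intro primitive_idempotents_orthogonal idempotents) auto

lemma bm_eq_sum:
  assumes "\<And>j. j \<le> D \<Longrightarrow> f j = (\<Sum>i\<le>D. c i * e i j)"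
  shows "bm f = (\<lambda>x y. \<Sum>i\<le>D. c i * E i x y)"
proof -
  have "bm f = bm (\<lambda>j. \<Sum>i\<le>D. c i * e i j)"
    using assms by (rule bm_cong)
  then show ?thesis
    by (simp add: bm_sum E_eq)
qed

text \<open>Expand \<open>bm f\<close> in the idempotents: orthogonality leaves the
  \<open>i\<close>-th term only, so \<open>c i\<close> is the eigenvalue of \<open>bm f\<close> on
  the image of \<open>E i\<close>.\<close>

lemma mp_bm_idempotent:
  assumes "\<And>j. j \<le> D \<Longrightarrow> f j = (\<Sum>i\<le>D. c i * e i j)" and i: "i \<le> D"
  shows "mp (bm f) (E i) = (\<lambda>x y. c i * E i x y)"
proof (intro ext)
  fix x y
  have "mp (bm f) (E i) x y = (\<Sum>v\<in>X. \<Sum>m\<le>D. c m * (E m x v * E i v y))"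
    by (subst bm_eq_sum[of f c]) (simp_all add: assms mat_prod_def sum_distrib_right mult.assoc)
  also have "\<dots> = (\<Sum>m\<le>D. c m * mp (E m) (E i) x y)"
    by (subst sum.swap) (simp add: mat_prod_def sum_distrib_left)
  also have "\<dots> = (\<Sum>m\<le>D. if m = i then c i * E i x y else 0)"
    using i by (intro sum.cong refl) (auto simp: idempotent orthogonal)
  finally show "mp (bm f) (E i) x y = c i * E i x y"
    using i by simp
qed

text \<open>The adjoint of \<open>E i\<close> lies in the Bose--Mesner algebra, hence acts on \<open>E i\<close> as a scalar.
  This replaces the fact that the \<open>E i\<close> are real.\<close>

lemma adjoint_idempotent:
  assumes i: "i \<le> D"
  obtains c where "mp (\<lambda>x y. cnj (E i y x)) (E i) = (\<lambda>x y. c * E i x y)"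
proof -
  have "(\<lambda>x y. cnj (E i y x)) = bm (\<lambda>j. cnj (e i j))"
    using i by (auto simp: E_eq bm_def gdist_commute fun_eq_iff)
  moreover obtain c where "\<And>j. j \<le> D \<Longrightarrow> cnj (e i j) = (\<Sum>m\<le>D. c m * e m j)"
    using in_e_span[of "\<lambda>j. cnj (e i j)"] unfolding e_span_def by blast
  ultimately show ?thesis
    using that mp_bm_idempotent[of "\<lambda>j. cnj (e i j)" c i] i by metis
qed

text \<open>By \<open>adjoint_idempotent\<close>, the diagonal of the adjoint of \<open>E i\<close>
  times \<open>E i\<close> is a multiple of \<open>e i 0\<close>. Its entries are the squared norms
  of the columns of \<open>E i\<close>, which cannot all vanish.\<close>

lemma e_at_0_nonzero:
  assumes i: "i \<le> D"
  shows "e i 0 \<noteq> 0"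
proof
  assume 0: "e i 0 = 0"
  obtain c where c: "mp (\<lambda>x y. cnj (E i y x)) (E i) = (\<lambda>x y. c * E i x y)"
    using adjoint_idempotent[OF i] .
  have "E i x y = 0" for x y
  proof (cases "x \<in> X \<and> y \<in> X")
    case True
    have "(\<Sum>v\<in>X. cnj (E i v y) * E i v y) = c * E i y y"
      using fun_cong[OF fun_cong[OF c, of y], of y] by (simp add: mat_prod_def)
    also have "\<dots> = 0"
      using 0 i by (simp add: E_eq bm_def)
    finally have "of_real (\<Sum>v\<in>X. (cmod (E i v y))\<^sup>2) = (0 :: complex)"
      by (simp add: complex_norm_square mult.commute flip: of_real_power)
    then have "(\<Sum>v\<in>X. (cmod (E i v y))\<^sup>2) = 0"
      by (simp only: of_real_eq_0_iff)
    then show ?thesis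
      using True finite_verts by (simp add: sum_nonneg_eq_0_iff)
  next
    case False
    then show ?thesis
      using i by (auto simp: E_eq bm_def)
  qed
  then have "E i = (\<lambda>x y. 0)"
    by auto
  then show False
    using idempotents[OF i] by (simp add: primitive_idempotent_def)
qed

text \<open>By \<open>adjoint_idempotent\<close>, the squared norm of the projected vector is a
  multiple of the quadratic form of \<open>E i\<close>.\<close>

lemma projection_eq_0:
  assumes i: "i \<le> D" and "quad_form X (E i) (char_vec Y) = 0" and x: "x \<in> X"
  shows "(\<Sum>y\<in>X. E i x y * char_vec Y y) = 0"
proof -
  define v where "v x = (\<Sum>y\<in>X. E i x y * char_vec Y y)" for x
  obtain c where c: "mp (\<lambda>x y. cnj (E i y x)) (E i) = (\<lambda>x y. c * E i x y)"
    using adjoint_idempotent[OF i] .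
  have "(\<Sum>x\<in>X. cnj (v x) * v x)
      = (\<Sum>x\<in>X. \<Sum>y\<in>X. \<Sum>y'\<in>X. char_vec Y y * (cnj (E i x y) * E i x y') * char_vec Y y')"
    unfolding v_def cnj_sum sum_product
    by (intro sum.cong refl) (simp add: char_vec_def)
  also have "\<dots> = (\<Sum>y\<in>X. \<Sum>x\<in>X. \<Sum>y'\<in>X. char_vec Y y * (cnj (E i x y) * E i x y') * char_vec Y y')"
    by (rule sum.swap)
  also have "\<dots> = (\<Sum>y\<in>X. \<Sum>y'\<in>X. \<Sum>x\<in>X. char_vec Y y * (cnj (E i x y) * E i x y') * char_vec Y y')"
    by (rule sum.cong[OF refl]) (rule sum.swap)
  also have "\<dots> = (\<Sum>y\<in>X. \<Sum>y'\<in>X. char_vec Y y * mp (\<lambda>x y. cnj (E i y x)) (E i) y y' * char_vec Y y')"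
    by (simp add: mat_prod_def sum_distrib_left sum_distrib_right)
  also have "\<dots> = c * quad_form X (E i) (char_vec Y)"
    unfolding c quad_form_def by (simp add: sum_distrib_left mult_ac)
  finally have "of_real (\<Sum>x\<in>X. (cmod (v x))\<^sup>2) = (0 :: complex)"
    using assms(2) by (simp add: complex_norm_square mult.commute flip: of_real_power)
  then have "(\<Sum>x\<in>X. (cmod (v x))\<^sup>2) = 0"
    by (simp only: of_real_eq_0_iff)
  then have "v x = 0"
    using x finite_verts by (simp add: sum_nonneg_eq_0_iff)
  then show ?thesis
    by (simp add: v_def)
qed

text \<open>Since \<open>cs i\<close> is nonzero, the recurrence can be solved for
  \<open>e i\<close> in terms of the two preceding functions; each step raises the degree bound by
  one.\<close>

lemma e_poly:
  assumes "i \<le> D"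
  shows "\<exists>P. degree P \<le> i \<and> (\<forall>j\<le>D. e i j = poly P (\<theta> j))"
  using assms
proof (induction i rule: less_induct)
  case (less i)
  show ?case
  proof (cases i)
    case 0
    then show ?thesis
      by (intro exI[of _ "[:1 / of_nat (card X):]"]) (simp add: e_0)
  next
    case (Suc m)
    obtain P where P: "degree P \<le> m" "\<And>j. j \<le> D \<Longrightarrow> e m j = poly P (\<theta> j)"
      using less.IH[of m] less.prems Suc by auto
    obtain Q where Q: "degree Q \<le> m"
      "\<And>j. j \<le> D \<Longrightarrow> (if m = 0 then 0 else bs (m - 1) * e (m - 1) j) = poly Q (\<theta> j)"
    proof (cases m)
      case 0
      then show ?thesis
        by (intro that[of 0]) auto
    next
      case (Suc k)
      then obtain R where "degree R \<le> k" "\<And>j. j \<le> D \<Longrightarrow> e k j = poly R (\<theta> j)"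
        using less.IH[of k] less.prems \<open>i = Suc m\<close> by auto
      then show ?thesis
        using Suc by (intro that[of "Polynomial.smult (bs k) R"]) auto
    qed
    have cs: "cs i \<noteq> 0"
      using cs_nonzero Suc less.prems by simp
    define R where "R = Polynomial.smult (1 / cs i) ([:- as m, 1:] * P - Q)"
    have "degree ([:- as m, 1:] * P) \<le> i"
      using degree_mult_le[of "[:- as m, 1:]" P] P(1) Suc by simp
    then have "degree R \<le> i"
      unfolding R_def using Q(1) Suc by (intro order_trans[OF degree_smult_le] degree_diff_le) auto
    moreover have "e i j = poly R (\<theta> j)" if j: "j \<le> D" for j
    proof -
      have "\<theta> j * e m j = poly Q (\<theta> j) + as m * e m j + cs i * e i j"
        using recurrence[of m j] Q(2)[OF j] less.prems Suc j by simp
      then show ?thesis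
        using cs P(2)[OF j] by (simp add: R_def field_simps)
    qed
    ultimately show ?thesis
      by blast
  qed
qed

text \<open>Only the projections of \<open>Y\<close> to the images of \<open>E 0, \<dots>, E s\<close> are nonzero, and the eigenvalue of
  the \<open>j\<close>-th distance matrix on the image of \<open>E i\<close> is the valency times \<open>e i j / e i 0\<close>.\<close>

lemma outer_distribution_poly:
  assumes s: "\<And>i. \<lbrakk>s < i; i \<le> D\<rbrakk> \<Longrightarrow> quad_form X (E i) (char_vec Y) = 0"
    and Y: "Y \<subseteq> X" and x: "x \<in> X"
  obtains F where "degree F \<le> s"
    "\<And>j. j \<le> D \<Longrightarrow>
       of_nat (card {y \<in> Y. gdist \<Gamma> x y = j}) = of_nat (p j j 0) * poly F (\<theta> j)"
proof -
  define v where "v i = (\<Sum>y\<in>X. E i x y * char_vec Y y)" for i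
  have v_eq_0: "v i = 0" if "s < i" "i \<le> D" for i
    unfolding v_def using projection_eq_0[OF that(2) s[OF that] x] .
  obtain P where P: "\<And>i. i \<le> D \<Longrightarrow> degree (P i) \<le> i"
    "\<And>i j. \<lbrakk>i \<le> D; j \<le> D\<rbrakk> \<Longrightarrow> e i j = poly (P i) (\<theta> j)"
    using e_poly by metis
  define I where "I = {i. i \<le> s \<and> i \<le> D}"
  have [simp]: "finite I"
    unfolding I_def by simp
  define F where "F = (\<Sum>i\<in>I. Polynomial.smult (v i / e i 0) (P i))"
  have "degree F \<le> s"
    unfolding F_def using P(1)
    by (intro degree_sum_le order_trans[OF degree_smult_le]) (force simp: I_def)+
  moreover have "of_nat (card {y \<in> Y. gdist \<Gamma> x y = j}) = of_nat (p j j 0) * poly F (\<theta> j)"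
    if j: "j \<le> D" for j
  proof -
    define \<delta> :: "nat \<Rightarrow> complex" where "\<delta> m = (if m = j then 1 else 0)" for m
    obtain c where c: "\<And>m. m \<le> D \<Longrightarrow> \<delta> m = (\<Sum>i\<le>D. c i * e i m)"
      using in_e_span[of \<delta>] unfolding e_span_def by blast
    have c_eq: "c i = of_nat (p j j 0) * e i j / e i 0" if i: "i \<le> D" for i
    proof -
      have "c i * e i 0 = mp (bm \<delta>) (E i) x x"
        using mp_bm_idempotent[of \<delta> c i] c i x by (simp add: E_eq bm_def)
      also have "\<dots> = (\<Sum>u\<in>X. if gdist \<Gamma> x u = j then e i j else 0)"
        unfolding mat_prod_def using i x
        by (intro sum.cong refl) (auto simp: E_eq bm_def \<delta>_def gdist_commute)
      also have "\<dots> = of_nat (card {u \<in> X. gdist \<Gamma> x u = j}) * e i j"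
        using finite_verts by (simp flip: sum.inter_filter)
      finally show ?thesis
        using valency[OF x] e_at_0_nonzero[OF i] by (simp add: field_simps)
    qed
    have "of_nat (card {y \<in> Y. gdist \<Gamma> x y = j}) = (\<Sum>y\<in>{y\<in>Y. gdist \<Gamma> x y = j}. 1 :: complex)"
      by simp
    also have "\<dots> = (\<Sum>y\<in>X. bm \<delta> x y * char_vec Y y)"
      using finite_verts Y x
      by (intro sum.mono_neutral_cong_left) (auto simp: bm_def \<delta>_def char_vec_def split: if_splits)
    also have "\<dots> = (\<Sum>y\<in>X. \<Sum>i\<le>D. c i * (E i x y * char_vec Y y))"
      using bm_eq_sum[of \<delta> c] c by (simp add: sum_distrib_right mult.assoc)
    also have "\<dots> = (\<Sum>i\<le>D. c i * v i)"
      by (subst sum.swap) (simp add: v_def sum_distrib_left)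
    also have "\<dots> = (\<Sum>i\<in>I. c i * v i)"
    proof (intro sum.mono_neutral_right ballI)
      fix i assume "i \<in> {..D} - I"
      then have "s < i" "i \<le> D"
        by (auto simp: I_def)
      then show "c i * v i = 0"
        using v_eq_0 by simp
    qed (auto simp: I_def)
    also have "\<dots> = of_nat (p j j 0) * poly F (\<theta> j)"
      unfolding F_def poly_sum sum_distrib_left using P(2) j
      by (intro sum.cong refl) (auto simp: I_def c_eq)
    finally show ?thesis .
  qed
  ultimately show ?thesis
    using that by blast
qed

end

subsection \<open>Bases less than \<open>-1\<close>\<close>

text \<open>The roots determine \<open>F\<close> up to a factor. If \<open>a\<close> is not in
  \<open>S\<close> and \<open>R\<close> is the product of the linear factors, then
  \<open>R(a) F - F(a) R\<close> has degree at most \<open>card S\<close> but vanishes on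
  \<open>S\<close> and at \<open>a\<close>, so it is zero.\<close>

lemma poly_ratio:
  fixes F :: "complex poly"
  assumes "finite S" "degree F \<le> card S" "\<And>s. s \<in> S \<Longrightarrow> poly F s = 0"
  shows "poly F a * (\<Prod>s\<in>S. b - s) = poly F b * (\<Prod>s\<in>S. a - s)"
proof (cases "a \<in> S")
  case True
  then have "(\<Prod>s\<in>S. a - s) = 0"
    using assms(1) by (auto intro: prod_zero)
  then show ?thesis
    using True assms(3) by simp
next
  case False
  define R where "R = (\<Prod>s\<in>S. [:- s, 1:])"
  have R: "poly R t = (\<Prod>s\<in>S. t - s)" for t
    by (simp add: R_def poly_prod)
  have "degree R = card S"
    unfolding R_def by (subst degree_prod_sum_eq) auto
  then have "degree (Polynomial.smult (poly R a) F - Polynomial.smult (poly F a) R) \<le> card S"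
    using assms(2) by (intro degree_diff_le order_trans[OF degree_smult_le]) auto
  then have "Polynomial.smult (poly R a) F - Polynomial.smult (poly F a) R = 0"
    using False assms(1,3)
    by (intro poly_eqI_degree[of "insert a S"]) (auto simp: R intro: prod_zero)
  then have "poly (Polynomial.smult (poly R a) F - Polynomial.smult (poly F a) R) b = 0"
    by simp
  then show ?thesis
    by (simp add: R mult_ac)
qed

text \<open>The quotient of the two products telescopes to \<open>f m / f n\<close>; the statement
  avoids division.\<close>

lemma prod_shift_telescope:
  fixes f :: "nat \<Rightarrow> 'a :: comm_monoid_mult"
  assumes "m \<le> n"
  shows "(\<Prod>i\<in>{m<..n}. f (i - 1)) * f n = (\<Prod>i\<in>{m<..n}. f i) * f m"
  using assms
proof (induction n rule: dec_induct)
  case (step n)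
  then have "{m<..Suc n} = insert (Suc n) {m<..n}"
    by auto
  then show ?case
    using step.IH by (simp add: mult_ac)
qed simp

text \<open>This is \<open>a / b = d / c = r / s\<close> with denominators cleared, so that only
  \<open>d\<close> has to be cancelled.\<close>

lemma cross_cancel:
  fixes a b c d r s :: "'a :: idom"
  assumes "a * c = b * d" "c * r = d * s" "d \<noteq> 0"
  shows "a * s = b * r"
proof -
  have "d * (a * s) = a * (c * r)"
    using assms(2) by (simp add: mult_ac)
  also have "\<dots> = (b * d) * r"
    by (simp only: assms(1) flip: mult.assoc)
  also have "\<dots> = d * (b * r)"
    by (simp add: mult_ac)
  finally show ?thesis
    using assms(3) by simp
qed

section \<open>q-integers for a negative base\<close>

lemma q_int_mult: "(1 - q) * q_int q n = 1 - q ^ n"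
  unfolding q_int_def by (simp add: one_diff_power_eq)

lemma q_int_add: "q_int q (m + k) = q_int q m + q ^ m * q_int q k"
  unfolding q_int_def by (induction k) (simp_all add: power_add algebra_simps)

lemma q_int_diff:
  assumes "a \<le> i" "i \<le> n"
  shows "q_int q (n - a) - q_int q (n - i) = q ^ (n - i) * q_int q (i - a)"
proof -
  have "n - a = (n - i) + (i - a)"
    using assms by simp
  then show ?thesis
    using q_int_add[of q "n - i" "i - a"] by simp
qed

text \<open>The closed form \<open>(1 - (- l) ^ i) / (1 + l)\<close> is real, and since
  \<open>l ^ i > 1\<close> its sign is decided by the parity of \<open>i\<close>.\<close>

lemma q_int_neg:
  assumes "l \<ge> 2" "i \<ge> 1"
  obtains r where "q_int (- of_nat l) i = of_real r" "if odd i then r > 0 else r < 0"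
proof -
  define r where "r = (1 - (- real l) ^ i) / (1 + real l)"
  have "(1 + of_nat l) * q_int (- of_nat l) i = 1 - (- of_nat l) ^ i"
    using q_int_mult[of "- of_nat l" i] by simp
  also have "\<dots> = of_real (1 - (- real l) ^ i)"
    by simp
  finally have "(1 + of_nat l) * q_int (- of_nat l) i = of_real (1 - (- real l) ^ i)" .
  moreover have "1 + of_nat l = (of_real (1 + real l) :: complex)"
    by simp
  moreover have "1 + real l \<noteq> 0"
    by linarith
  ultimately have "q_int (- of_nat l) i = of_real r"
    unfolding r_def of_real_divide
    by (metis nonzero_mult_div_cancel_left of_real_eq_0_iff)
  moreover have "real l ^ i > 1"
    using assms by simp
  then have "if odd i then r > 0 else r < 0"
    by (auto simp: r_def power_minus_odd power_minus_even divide_simps)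
  ultimately show ?thesis
    using that by blast
qed

text \<open>Both q-integers are nonzero reals with signs given by the parity of the index. The left
  side is nonzero with the sign of the first, so \<open>t\<close> is positive and the signs
  agree.\<close>

lemma q_int_ratio_parity:
  assumes l: "l \<ge> 2" and mn: "m \<ge> 1" "n \<ge> 1" and "s > 0" "t \<ge> 0"
    and eq: "of_real s * q_int (- of_nat l) m = of_real t * q_int (- of_nat l) n"
  shows "even m \<longleftrightarrow> even n"
proof -
  obtain a where a: "q_int (- of_nat l) m = of_real a" "if odd m then a > 0 else a < 0"
    using q_int_neg[OF l mn(1)] .
  obtain b where b: "q_int (- of_nat l) n = of_real b" "if odd n then b > 0 else b < 0"
    using q_int_neg[OF l mn(2)] .
  have "of_real (s * a) = (of_real (t * b) :: complex)"
    using eq a(1) b(1) by simp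
  then have eq': "s * a = t * b"
    by (simp only: of_real_eq_iff)
  show ?thesis
  proof (rule ccontr)
    assume "even m \<noteq> even n"
    then consider "a > 0" "b < 0" | "a < 0" "b > 0"
      using a(2) b(2) by (auto split: if_splits)
    then show False
    proof cases
      case 1
      then have "s * a > 0" "t * b \<le> 0"
        using assms(4,5) by (simp_all add: mult_nonneg_nonpos)
      then show False
        using eq' by linarith
    next
      case 2
      then have "s * a < 0" "t * b \<ge> 0"
        using assms(4,5) by (simp_all add: mult_pos_neg)
      then show False
        using eq' by linarith
    qed
  qed
qed

section \<open>Parity obstruction for the width of a descendent\<close>

locale negative_base_graph = Q_polynomial_graph \<Gamma> p E e \<theta> as bs cs
  for \<Gamma> :: "'v graph" and p E e \<theta> as bs cs +
  fixes l :: nat and \<xi> \<zeta> :: complex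
  assumes l_ge_2: "l \<ge> 2"
    and \<theta>_eq: "i \<le> gdiam \<Gamma> \<Longrightarrow> \<theta> i = \<xi> * q_int (- of_nat l) (gdiam \<Gamma> - i) + \<zeta>"
    and \<xi>_nonzero: "\<xi> \<noteq> 0"
begin

abbreviation "q \<equiv> - of_nat l :: complex"

lemma q_int_nonzero: "i \<ge> 1 \<Longrightarrow> q_int q i \<noteq> 0"
  by (rule q_int_neg[OF l_ge_2, of i]) (auto split: if_splits)

lemma q_nonzero: "q \<noteq> 0"
  using l_ge_2 by simp

lemma \<theta>_diff: "\<lbrakk>a \<le> i; i \<le> D\<rbrakk> \<Longrightarrow> \<theta> a - \<theta> i = \<xi> * q ^ (D - i) * q_int q (i - a)"
  using q_int_diff[of a i D q] by (simp add: \<theta>_eq mult.assoc flip: right_diff_distrib)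

lemma inj_on_\<theta>: "J \<subseteq> {..D} \<Longrightarrow> inj_on \<theta> J"
  using inj_\<theta> inj_on_subset by blast

text \<open>The first product does not involve \<open>a\<close>, so it cancels when two such
  products over the same range are compared.\<close>

lemma \<theta>_prod:
  assumes "a \<le> m"
  shows "(\<Prod>s\<in>\<theta> ` {m<..D}. \<theta> a - s)
    = (\<Prod>i\<in>{m<..D}. \<xi> * q ^ (D - i)) * (\<Prod>i\<in>{m<..D}. q_int q (i - a))"
proof -
  have "(\<Prod>s\<in>\<theta> ` {m<..D}. \<theta> a - s) = (\<Prod>i\<in>{m<..D}. \<theta> a - \<theta> i)"
    by (subst prod.reindex) (auto intro: inj_on_\<theta>)
  also have "\<dots> = (\<Prod>i\<in>{m<..D}. \<xi> * q ^ (D - i) * q_int q (i - a))"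
    using assms by (intro prod.cong refl \<theta>_diff) auto
  finally show ?thesis
    by (simp add: prod.distrib)
qed

lemma \<theta>_prod_nonzero: "(\<Prod>i\<in>{m<..D}. \<xi> * q ^ (D - i)) \<noteq> 0"
  using \<xi>_nonzero q_nonzero by simp

text \<open>Replacing \<open>a\<close> by \<open>Suc a\<close> shifts all q-integers by one, and the
  quotient telescopes. The case \<open>a = 0\<close> serves the vertices of \<open>Y\<close>, the
  case \<open>a = 1\<close> those at distance one from \<open>Y\<close>.\<close>

lemma \<theta>_prod_ratio:
  assumes w: "1 \<le> w" "w + a \<le> D"
  shows "(\<Prod>s\<in>\<theta> ` {w + a<..D}. \<theta> (Suc a) - s) * q_int q (D - a)
       = (\<Prod>s\<in>\<theta> ` {w + a<..D}. \<theta> a - s) * q_int q w"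
proof -
  have "(\<Prod>i\<in>{w + a<..D}. q_int q (i - Suc a)) = (\<Prod>i\<in>{w + a<..D}. q_int q (i - 1 - a))"
    by (simp add: diff_diff_eq add.commute)
  moreover have "(\<Prod>i\<in>{w + a<..D}. q_int q (i - 1 - a)) * q_int q (D - a)
      = (\<Prod>i\<in>{w + a<..D}. q_int q (i - a)) * q_int q (w + a - a)"
    using prod_shift_telescope[OF w(2), of "\<lambda>i. q_int q (i - a)"] .
  ultimately show ?thesis
    using w by (simp add: \<theta>_prod mult.assoc)
qed

lemma \<theta>_prod_not_0: "a \<le> m \<Longrightarrow> (\<Prod>s\<in>\<theta> ` {m<..D}. \<theta> a - s) \<noteq> 0"
  using \<theta>_prod_nonzero[of m] q_int_nonzero by (simp add: \<theta>_prod del: prod_zero_iff) (simp add: Suc_le_eq)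

text \<open>The quadratic form of the \<open>i\<close>-th distance matrix counts the ordered pairs
  of \<open>Y\<close> at distance \<open>i\<close>, so a single such pair makes it nonzero.\<close>

lemma gdist_le_width:
  assumes Y: "Y \<subseteq> X" and "x \<in> Y" "y \<in> Y"
  shows "gdist \<Gamma> x y \<le> width \<Gamma> Y"
proof (rule ccontr)
  assume neg: "\<not> gdist \<Gamma> x y \<le> width \<Gamma> Y"
  define i where "i = gdist \<Gamma> x y"
  have i: "i \<le> D"
    using assms gdist_le_gdiam by (auto simp: i_def)
  define f :: "'v \<Rightarrow> 'v \<Rightarrow> real"
    where "f u v = (if u \<in> Y \<and> v \<in> Y \<and> gdist \<Gamma> u v = i then 1 else 0)" for u v
  have f_nonneg: "f u v \<ge> 0" for u v
    by (simp add: f_def)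
  have xy: "x \<in> X" "y \<in> X" "f x y > 0"
    using assms by (auto simp: f_def i_def)
  have "(\<Sum>v\<in>X. f x v) > 0"
    by (rule sum_pos2[OF finite_verts xy(2)]) (rule xy(3), rule f_nonneg)
  then have pos: "(\<Sum>u\<in>X. \<Sum>v\<in>X. f u v) > 0"
    by (rule sum_pos2[OF finite_verts xy(1)]) (intro sum_nonneg f_nonneg)
  have "quad_form X (dist_matrix \<Gamma> i) (char_vec Y) = of_real (\<Sum>u\<in>X. \<Sum>v\<in>X. f u v)"
    unfolding quad_form_def of_real_sum
    by (intro sum.cong refl) (auto simp: char_vec_def dist_matrix_def f_def)
  then have "quad_form X (dist_matrix \<Gamma> i) (char_vec Y) \<noteq> 0"
    using pos by (simp del: of_real_sum)
  then have "i \<le> width \<Gamma> Y"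
    unfolding width_def using i by (intro Max_ge) auto
  then show False
    using neg by (simp add: i_def)
qed

lemma dual_width_zero:
  assumes "dual_width \<Gamma> E Y < i" "i \<le> D"
  shows "quad_form X (E i) (char_vec Y) = 0"
proof (rule ccontr)
  assume "quad_form X (E i) (char_vec Y) \<noteq> 0"
  then have "i \<le> dual_width \<Gamma> E Y"
    unfolding dual_width_def using assms by (intro Max_ge) auto
  then show False
    using assms by simp
qed

lemma no_nontrivial_descendent: "\<not> nontrivial_descendent \<Gamma> E Y"
proof
  assume "nontrivial_descendent \<Gamma> E Y"
  then have Y: "Y \<noteq> {}" "Y \<subseteq> X"
    and sum: "width \<Gamma> Y + dual_width \<Gamma> E Y = D" and "width \<Gamma> Y \<noteq> 0" "width \<Gamma> Y \<noteq> D"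
    unfolding nontrivial_descendent_def descendent_def by auto
  define w where "w = width \<Gamma> Y"
  have w: "1 \<le> w" "w < D"
    using sum \<open>width \<Gamma> Y \<noteq> 0\<close> \<open>width \<Gamma> Y \<noteq> D\<close> by (auto simp: w_def)
  have diam_Y: "gdist \<Gamma> x y \<le> w" if "x \<in> Y" "y \<in> Y" for x y
    using gdist_le_width[OF Y(2) that] by (simp add: w_def)
  have [simp]: "finite Y"
    using Y(2) finite_verts finite_subset by blast
  define n where "n x j = card {y \<in> Y. gdist \<Gamma> x y = j}" for x j
  define k where "k j = p j j 0" for j
  have k: "k j > 0" if "j \<le> D" for j
    unfolding k_def using valency_pos nonempty that by blast
  \<comment> \<open>Normalised by the valencies, the distance counts from \<open>x\<close> are
    nonnegative reals and values of one polynomial of degree at most \<open>D - w\<close>.\<close>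
  have outer: "\<exists>F. degree F \<le> D - w \<and> (\<forall>j\<le>D. poly F (\<theta> j) = of_real (n x j / k j))" if x: "x \<in> X" for x
  proof -
    obtain F where F: "degree F \<le> dual_width \<Gamma> E Y"
      "\<And>j. j \<le> D \<Longrightarrow> of_nat (n x j) = of_nat (k j) * poly F (\<theta> j)"
      using outer_distribution_poly[OF dual_width_zero Y(2) x] unfolding n_def k_def by blast
    have "poly F (\<theta> j) = of_real (n x j / k j)" if "j \<le> D" for j
      using F(2)[OF that] k[OF that] by (simp add: field_simps)
    moreover have "dual_width \<Gamma> E Y = D - w"
      using sum by (simp add: w_def)
    ultimately show ?thesis
      using F(1) by auto
  qed
  have card_\<theta>: "card (\<theta> ` {m<..D}) = D - m" for m
    by (subst card_image) (auto intro: inj_on_\<theta>)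

  have "even w \<longleftrightarrow> even D"
  proof -
    obtain x where x: "x \<in> Y"
      using Y(1) by blast
    then obtain F where F: "degree F \<le> D - w" "\<And>j. j \<le> D \<Longrightarrow> poly F (\<theta> j) = of_real (n x j / k j)"
      using outer[of x] Y(2) by blast
    have zero: "n x j = 0" if "j > w" for j
      unfolding n_def using diam_Y[OF x] that by force
    \<comment> \<open>The \<open>D - w\<close> points \<open>\<theta> j\<close> with
      \<open>w < j\<close> are roots, as many as the degree bound allows.\<close>
    have "poly F (\<theta> 0) * (\<Prod>s\<in>\<theta> ` {w<..D}. \<theta> 1 - s)
        = poly F (\<theta> 1) * (\<Prod>s\<in>\<theta> ` {w<..D}. \<theta> 0 - s)"
      using F zero by (intro poly_ratio) (auto simp: card_\<theta>)
    moreover have "(\<Prod>s\<in>\<theta> ` {w<..D}. \<theta> 1 - s) * q_int q D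
        = (\<Prod>s\<in>\<theta> ` {w<..D}. \<theta> 0 - s) * q_int q w"
      using \<theta>_prod_ratio[of w 0] w by simp
    moreover have "(\<Prod>s\<in>\<theta> ` {w<..D}. \<theta> 0 - s) \<noteq> 0"
      by (rule \<theta>_prod_not_0) simp
    ultimately have eq: "poly F (\<theta> 0) * q_int q w = poly F (\<theta> 1) * q_int q D"
      by (rule cross_cancel)
    have "x \<in> {y \<in> Y. gdist \<Gamma> x y = 0}"
      using x by simp
    then have "n x 0 > 0"
      unfolding n_def by (subst card_gt_0_iff) auto
    then show ?thesis
      using eq F(2) w k[of 0]
      by (intro q_int_ratio_parity[OF l_ge_2, of w D "n x 0 / k 0" "n x 1 / k 1"]) auto
  qed
  moreover have "even w \<longleftrightarrow> even (D - 1)"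
  proof -
    have "Y \<noteq> X"
    proof
      assume "Y = X"
      obtain x y where "x \<in> X" "y \<in> X" "gdist \<Gamma> x y = D"
        using gdist_surj[OF nonempty order_refl] .
      then show False
        using diam_Y[of x y] \<open>Y = X\<close> w by simp
    qed
    then obtain x v where x: "x \<in> X" "x \<notin> Y" and v: "v \<in> Y" "gdist \<Gamma> x v = 1"
      using exists_boundary_vertex[OF Y(2,1)] by blast
    then obtain F where F: "degree F \<le> D - w" "\<And>j. j \<le> D \<Longrightarrow> poly F (\<theta> j) = of_real (n x j / k j)"
      using outer[of x] Y(2) by blast
    have zero: "n x j = 0" if j: "j > w + 1" for j
    proof -
      have "gdist \<Gamma> x y < j" if y: "y \<in> Y" for y
      proof -
        have "gdist \<Gamma> x y \<le> gdist \<Gamma> x v + gdist \<Gamma> v y"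
          using x v y Y(2) by (intro gdist_triangle) auto
        then show ?thesis
          using diam_Y[OF v(1) y] v(2) j by linarith
      qed
      then show ?thesis
        unfolding n_def by fastforce
    qed
    have "gdist \<Gamma> x y \<noteq> 0" if "y \<in> Y" for y
      using that x Y(2) gdist_eq_0_iff[of x y] by auto
    then have zero': "n x 0 = 0"
      unfolding n_def by auto
    \<comment> \<open>From \<open>x\<close> the point \<open>\<theta> (w + 1)\<close> need not be a
      root, but \<open>\<theta> 0\<close> is one since \<open>x\<close> lies outside
      \<open>Y\<close>. So there are again \<open>D - w\<close> roots.\<close>
    define S where "S = \<theta> ` {w + 1<..D}"
    have S: "finite S" "\<theta> 0 \<notin> S"
      unfolding S_def using w by (auto dest: inj_onD[OF inj_\<theta>])
    have "card (insert (\<theta> 0) S) = D - w"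
      using S w by (simp add: S_def card_\<theta>)
    then have "poly F (\<theta> 1) * (\<Prod>s\<in>insert (\<theta> 0) S. \<theta> 2 - s)
        = poly F (\<theta> 2) * (\<Prod>s\<in>insert (\<theta> 0) S. \<theta> 1 - s)"
      using F zero zero' by (intro poly_ratio) (auto simp: S_def)
    then have "poly F (\<theta> 1) * (\<theta> 2 - \<theta> 0) * (\<Prod>s\<in>S. \<theta> 2 - s)
        = poly F (\<theta> 2) * (\<theta> 1 - \<theta> 0) * (\<Prod>s\<in>S. \<theta> 1 - s)"
      using S by (simp add: mult.assoc)
    moreover have "(\<Prod>s\<in>S. \<theta> 2 - s) * q_int q (D - 1) = (\<Prod>s\<in>S. \<theta> 1 - s) * q_int q w"
      using \<theta>_prod_ratio[of w 1] w by (simp add: S_def numeral_2_eq_2)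
    moreover have "(\<Prod>s\<in>S. \<theta> 1 - s) \<noteq> 0"
      unfolding S_def by (rule \<theta>_prod_not_0) simp
    ultimately have "poly F (\<theta> 1) * (\<theta> 2 - \<theta> 0) * q_int q w
        = poly F (\<theta> 2) * (\<theta> 1 - \<theta> 0) * q_int q (D - 1)"
      by (rule cross_cancel)
    \<comment> \<open>This difference and the next share the factor
      \<open>- \<xi> * q ^ (D - 2)\<close>. What remains, \<open>1 + q = 1 - l\<close> and
      \<open>q = - l\<close>, are negative reals.\<close>
    moreover have "\<theta> 2 - \<theta> 0 = - \<xi> * q ^ (D - 2) * (1 + q)"
      using \<theta>_diff[of 0 2] w by (simp add: q_int_def numeral_2_eq_2 algebra_simps)
    moreover have "\<theta> 1 - \<theta> 0 = - \<xi> * q ^ (D - 2) * q"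
    proof -
      have "D - 1 = Suc (D - 2)"
        using w by simp
      then show ?thesis
        using \<theta>_diff[of 0 1] w by (simp add: q_int_def algebra_simps)
    qed
    ultimately have "\<xi> * q ^ (D - 2) * (poly F (\<theta> 1) * (1 + q) * q_int q w)
        = \<xi> * q ^ (D - 2) * (poly F (\<theta> 2) * q * q_int q (D - 1))"
      by (simp add: algebra_simps)
    moreover have "\<xi> * q ^ (D - 2) \<noteq> 0"
      using \<xi>_nonzero q_nonzero by simp
    ultimately have "poly F (\<theta> 1) * (1 + q) * q_int q w = poly F (\<theta> 2) * q * q_int q (D - 1)"
      using iffD1[OF mult_left_cancel] by blast
    \<comment> \<open>Negating both sides gives the coefficients the signs that
      \<open>q_int_ratio_parity\<close> asks for: the left one is positive because
      \<open>n x 1 > 0\<close> and \<open>l > 1\<close>, the right one is nonnegative.\<close>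
    moreover have "of_real (n x 1 / k 1 * (real l - 1)) = - (poly F (\<theta> 1) * (1 + q))"
    proof -
      have "of_real (r * (real l - 1)) = - (of_real r * (1 + q))" for r
        by (simp add: algebra_simps)
      moreover have "poly F (\<theta> 1) = of_real (n x 1 / k 1)"
        using w by (intro F(2)) simp
      ultimately show ?thesis
        by (simp only:)
    qed
    moreover have "of_real (n x 2 / k 2 * real l) = - (poly F (\<theta> 2) * q)"
      using F(2)[of 2] w by simp
    ultimately have eq: "of_real (n x 1 / k 1 * (real l - 1)) * q_int q w
        = of_real (n x 2 / k 2 * real l) * q_int q (D - 1)"
      by simp
    have "v \<in> {y \<in> Y. gdist \<Gamma> x y = 1}"
      using v by simp
    then have "n x 1 > 0"
      unfolding n_def by (subst card_gt_0_iff) auto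
    then show ?thesis
      using w k[of 1] l_ge_2 by (intro q_int_ratio_parity[OF l_ge_2 _ _ _ _ eq]) auto
  qed
  ultimately show False
    using w by (cases D) auto
qed

end

text \<open>Every distance up to \<open>D\<close> is attained, so the matrix identities can be
  evaluated at a pair at distance \<open>j\<close>; this yields the scalar assumptions of
  \<open>negative_base_graph\<close>. If \<open>D = 0\<close>, a descendent has width zero and is
  trivial.\<close>

theorem (in distance_regular) standard_ordering_no_nontrivial_descendent:
  assumes l: "l \<ge> 2" and E: "standard_Q_ordering \<Gamma> (- of_nat l) E"
  shows "\<not> nontrivial_descendent \<Gamma> E Y"
proof (cases "X \<noteq> {} \<and> D \<ge> 1")
  case False
  show ?thesis
  proof
    assume "nontrivial_descendent \<Gamma> E Y"
    then have "Y \<noteq> {}" "Y \<subseteq> X" "width \<Gamma> Y + dual_width \<Gamma> E Y = D" "width \<Gamma> Y \<noteq> 0"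
      unfolding nontrivial_descendent_def descendent_def by simp_all
    then have "X \<noteq> {}" "D \<ge> 1"
      by (blast, linarith)
    then show False
      using False by simp
  qed
next
  case True
  have Q: "Q_polynomial \<Gamma> E"
    using E unfolding standard_Q_ordering_def by blast
  obtain \<theta> \<xi> \<zeta> where \<theta>: "(\<lambda>x y. of_nat (card X) * E 1 x y) =
        (\<lambda>x y. \<Sum>i\<le>D. \<theta> i * dist_matrix \<Gamma> i x y)"
    and \<xi>: "\<xi> \<noteq> 0" and \<theta>_eq: "\<And>i. i \<le> D \<Longrightarrow> \<theta> i = \<xi> * q_int (- of_nat l) (D - i) + \<zeta>"
    using E unfolding standard_Q_ordering_def by blast
  obtain as bs cs where nonzero: "\<And>i. i \<in> {1..D} \<Longrightarrow> bs (i - 1) * cs i \<noteq> 0"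
    and rec: "\<And>i. i \<le> D \<Longrightarrow> (\<lambda>x y. E 1 x y * E i x y) =
           (\<lambda>x y. ((if i = 0 then 0 else bs (i - 1) * E (i - 1) x y)
                   + as i * E i x y
                   + (if i = D then 0 else cs (i + 1) * E (i + 1) x y))
                  / of_nat (card X))"
    using Q unfolding Q_polynomial_def by blast
  have bij: "bij_betw E {..D} {F. primitive_idempotent \<Gamma> F}"
    and E0: "E 0 = (\<lambda>x y. all_ones_matrix X x y / of_nat (card X))"
    using Q unfolding Q_polynomial_def idempotent_ordering_def by auto
  have prim: "primitive_idempotent \<Gamma> (E i)" if "i \<le> D" for i
    using bij_betwE[OF bij] that by auto
  then have "\<forall>i. \<exists>f. i \<le> D \<longrightarrow> E i = bm f"
    unfolding primitive_idempotent_def bose_mesner_eq by blast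
  then obtain e where e: "\<And>i. i \<le> D \<Longrightarrow> E i = bm (e i)"
    by metis
  have card_pos: "card X > 0"
    using True finite_verts by (simp add: card_gt_0_iff)
  have E1: "of_nat (card X) * e 1 j = \<theta> j" if j: "j \<le> D" for j
  proof -
    obtain x y where xy: "x \<in> X" "y \<in> X" "gdist \<Gamma> x y = j"
      using gdist_surj[OF _ j] True by blast
    have "(\<Sum>i\<le>D. \<theta> i * dist_matrix \<Gamma> i x y) = (\<Sum>i\<le>D. if i = j then \<theta> j else 0)"
      using xy by (intro sum.cong) (auto simp: dist_matrix_def)
    then show ?thesis
      using fun_cong[OF fun_cong[OF \<theta>, of x], of y] e[of 1] True xy j by (simp add: bm_def)
  qed
  interpret negative_base_graph \<Gamma> p E e \<theta> as bs cs l \<xi> \<zeta>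
  proof
    show "1 \<le> D" "X \<noteq> {}"
      using True by auto
    show "inj_on E {..D}"
      using bij by (simp add: bij_betw_def)
    show "e 0 j = 1 / of_nat (card X)" if j: "j \<le> D" for j
    proof -
      obtain x y where "x \<in> X" "y \<in> X" "gdist \<Gamma> x y = j"
        using gdist_surj[OF _ j] True by blast
      then show ?thesis
        using fun_cong[OF fun_cong[OF E0, of x], of y] e[of 0] by (simp add: bm_def all_ones_matrix_def)
    qed
    show "cs i \<noteq> 0" if "i \<in> {1..D}" for i
      using nonzero[OF that] by auto
    show "\<theta> j * e i j = (if i = 0 then 0 else bs (i - 1) * e (i - 1) j) + as i * e i j
            + (if i = D then 0 else cs (i + 1) * e (i + 1) j)" if i: "i \<le> D" and j: "j \<le> D" for i j
    proof -
      obtain x y where xy: "x \<in> X" "y \<in> X" "gdist \<Gamma> x y = j"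
        using gdist_surj[OF _ j] True by blast
      have at: "E m x y = e m j" if "m \<le> D" for m
        using e[OF that] xy by (simp add: bm_def)
      have "E 1 x y * E i x y = ((if i = 0 then 0 else bs (i - 1) * E (i - 1) x y) + as i * E i x y
                   + (if i = D then 0 else cs (i + 1) * E (i + 1) x y)) / of_nat (card X)"
        using fun_cong[OF fun_cong[OF rec[OF i], of x], of y] .
      then have "of_nat (card X) * e 1 j * e i j
          = (if i = 0 then 0 else bs (i - 1) * E (i - 1) x y) + as i * E i x y
                   + (if i = D then 0 else cs (i + 1) * E (i + 1) x y)"
        using True i card_pos by (simp add: at field_simps)
      then show ?thesis
        using i E1[OF j] by (auto simp: at)
    qed
    show "inj_on \<theta> {..D}"
    proof (rule linorder_inj_onI)
      fix a i assume ai: "a < i" "a \<in> {..D}" "i \<in> {..D}"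
      then have "\<theta> a - \<theta> i = \<xi> * ((- of_nat l) ^ (D - i) * q_int (- of_nat l) (i - a))"
        using q_int_diff[of a i D "- of_nat l"] by (simp add: \<theta>_eq flip: right_diff_distrib)
      moreover have "q_int (- of_nat l) (i - a) \<noteq> 0"
        using ai by - (rule q_int_neg[OF l, of "i - a"], auto split: if_splits)
      ultimately have "\<theta> a - \<theta> i \<noteq> 0"
        using \<xi> l by simp
      then show "\<theta> a \<noteq> \<theta> i"
        by simp
    qed (rule linear)
  qed (rule l \<xi> | erule prim e \<theta>_eq)+
  show ?thesis
    by (rule no_nontrivial_descendent)
qed

section \<open>Hermitean spaces over finite fields\<close>

lemma card_power_eq_le:
  fixes t :: "'a :: idom"
  assumes "n > 0"
  shows "card {x. x ^ n = t} \<le> n"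
proof -
  define P where "P = Polynomial.monom 1 n - [:t:]"
  have "Polynomial.coeff P n = 1"
    using assms by (cases n) (simp_all add: P_def coeff_pCons)
  then have "P \<noteq> 0"
    by auto
  moreover have "{x. x ^ n = t} = {x. poly P x = 0}"
    by (simp add: P_def poly_monom)
  moreover have "degree P \<le> n"
    unfolding P_def by (intro degree_diff_le degree_monom_le) auto
  ultimately show ?thesis
    using card_poly_roots_bound[of P] by simp
qed

locale hermitean_space =
  fixes h :: "('a::{field,finite})^'n \<Rightarrow> 'a^'n \<Rightarrow> 'a" and l :: nat
  assumes hermitean: "hermitean_form l h"
    and nondegenerate: "nondegenerate h"
    and primepow: "primepow l"
    and card_field: "CARD('a) = l\<^sup>2"
begin

section \<open>The Frobenius map and the norm\<close>

lemma l_ge_2: "l \<ge> 2"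
  using primepow_gt_Suc_0[OF primepow] by simp

text \<open>The characteristic divides the field size \<open>l\<^sup>2\<close>, so it is the prime
  of which \<open>l\<close> is a power.\<close>

lemma frobenius_add: "(x + y) ^ l = x ^ l + (y :: 'a) ^ l"
proof -
  obtain r k where r: "prime r" "l = r ^ k"
    using primepow unfolding primepow_def by auto
  have char: "prime CHAR('a)"
    using prime_CHAR_semidom[where ?'a = 'a] finite_imp_CHAR_pos[where ?'a = 'a] by simp
  have "CHAR('a) dvd l\<^sup>2"
    using CHAR_dvd_CARD[where ?'a = 'a] card_field by simp
  then have "CHAR('a) dvd r"
    using char r(2) prime_dvd_power by (metis power_mult)
  then have "CHAR('a) = r"
    using char r(1) by (simp add: primes_dvd_imp_eq)
  then show ?thesis
    using freshmans_dream'[OF char] r(2) by blast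
qed

lemma frobenius_uminus: "(- x) ^ l = - ((x :: 'a) ^ l)"
proof -
  have "x ^ l + (- x) ^ l = 0"
    using frobenius_add[of x "- x"] l_ge_2 by (simp add: power_0_left)
  then show ?thesis
    by (rule minus_unique[symmetric])
qed

lemma h_add_left: "h (x + y) v = h x v + h y v"
  and h_scale_left: "h (c *s x) y = c * h x y"
  and h_flip: "h x y = h y x ^ l"
  using hermitean unfolding hermitean_form_def by blast+

lemma h_add_right: "h v (x + y) = h v x + h v y"
  by (simp only: h_flip[of v "x + y"] h_flip[of v x] h_flip[of v y] h_add_left frobenius_add)

lemma h_scale_right: "h x (c *s y) = c ^ l * h x y"
  by (simp only: h_flip[of x "c *s y"] h_flip[of x y] h_scale_left power_mult_distrib)

lemma h_0_left [simp]: "h 0 y = 0"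
  using h_scale_left[of 0 0 y] by simp

lemma h_0_right [simp]: "h x 0 = 0"
  using h_scale_right[of x 0 0] l_ge_2 by (simp add: power_0_left)

lemma h_diff_left: "h (x - y) v = h x v - h y v"
  using h_add_left[of "x - y" y v] by simp

lemma h_sum_left: "h (\<Sum>i\<in>I. f i) y = (\<Sum>i\<in>I. h (f i) y)"
  by (induction I rule: infinite_finite_induct) (simp_all add: h_add_left)

lemma h_sum_right: "h x (\<Sum>i\<in>I. f i) = (\<Sum>i\<in>I. h x (f i))"
  by (induction I rule: infinite_finite_induct) (simp_all add: h_add_right)

lemma h_eq_0_commute: "h x y = 0 \<longleftrightarrow> h y x = 0"
  using l_ge_2 by (metis h_flip power_0_left not_numeral_le_zero)

lemma eq_0_if_orthogonal: "(\<And>y. h x y = 0) \<Longrightarrow> x = 0"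
  using nondegenerate unfolding nondegenerate_def by blast

text \<open>A nonzero form takes every value \<open>t\<close>, and exchanging its arguments twice
  raises that value to the power \<open>l\<close> twice.\<close>

lemma frobenius_twice: "(t ^ l) ^ l = (t :: 'a)"
proof -
  define v :: "'a^'n" where "v = (\<chi> i. 1)"
  have "v \<noteq> 0"
    by (simp add: v_def vec_eq_iff)
  then obtain y where y: "h v y \<noteq> 0"
    using eq_0_if_orthogonal by blast
  have "h ((t / h v y) *s v) y = t"
    using y by (simp add: h_scale_left)
  then show ?thesis
    using h_flip by metis
qed

text \<open>The fixed points are \<open>0\<close> and roots of \<open>x ^ (l - 1) = 1\<close>, hence
  at most \<open>l\<close> in number, fewer than the \<open>l\<^sup>2\<close> field
  elements.\<close>

lemma exists_not_fixed: "\<exists>a::'a. a ^ l \<noteq> a"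
proof (rule ccontr)
  assume "\<not> ?thesis"
  then have fixed: "a ^ l = a" for a :: 'a
    by simp
  have "a = 0 \<or> a ^ (l - 1) = 1" for a :: 'a
    using fixed[of a] l_ge_2 by (cases l) auto
  then have "(UNIV :: 'a set) \<subseteq> insert 0 {x. x ^ (l - 1) = 1}"
    by auto
  then have "CARD('a) \<le> card (insert 0 {x::'a. x ^ (l - 1) = 1})"
    by (intro card_mono) auto
  also have "\<dots> \<le> Suc (card {x::'a. x ^ (l - 1) = 1})"
    by (rule card_insert_le_m1) auto
  also have "\<dots> \<le> l"
    using card_power_eq_le[of "l - 1" "1 :: 'a"] l_ge_2 by simp
  finally show False
    using card_field l_ge_2 by (simp add: power2_eq_square)
qed

text \<open>The difference \<open>a - a ^ l\<close> changes sign under the Frobenius map. Dividing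
  by such a scalar turns skew-Hermitean forms into Hermitean ones.\<close>

lemma exists_skew: "\<exists>c::'a. c \<noteq> 0 \<and> c ^ l = - c"
proof -
  obtain a :: 'a where a: "a ^ l \<noteq> a"
    using exists_not_fixed by blast
  have "(a - a ^ l) ^ l = a ^ l - a"
    using frobenius_add[of a "- (a ^ l)"] by (simp add: frobenius_uminus frobenius_twice)
  then show ?thesis
    using a by (intro exI[of _ "a - a ^ l"]) auto
qed

text \<open>The norm map has fibres of size at most \<open>l + 1\<close>, while the \<open>l\<^sup>2 - 1\<close> units map into the at most
  \<open>l - 1\<close> nonzero fixed points of the Frobenius map.\<close>

lemma norm_surj:
  assumes "b \<noteq> 0" "b ^ l = (b :: 'a)"
  shows "\<exists>a. a * a ^ l = b"
proof -
  define A where "A = UNIV - {0 :: 'a}"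
  define N where "N a = a * a ^ l" for a :: 'a
  define T where "T = {b::'a. b ^ (l - 1) = 1}"
  have T_iff: "b \<in> T \<longleftrightarrow> b \<noteq> 0 \<and> b ^ l = b" for b
    using l_ge_2 unfolding T_def by (cases l) (auto simp: power_0_left)
  have "N ` A \<subseteq> T"
    by (auto simp: T_iff N_def A_def power_mult_distrib frobenius_twice)
  moreover have "card T \<le> l - 1"
    unfolding T_def using l_ge_2 by (intro card_power_eq_le) auto
  moreover have "(l + 1) * (l - 1) \<le> (l + 1) * card (N ` A)"
  proof -
    have "card A = l\<^sup>2 - 1"
      unfolding A_def by (simp add: card_Diff_singleton card_field)
    then have "(l + 1) * (l - 1) = card A"
      using l_ge_2 by (simp add: power2_eq_square algebra_simps)
    also have "\<dots> = (\<Sum>y\<in>N ` A. card {x \<in> A. N x = y})"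
      using sum.image_gen[of A "\<lambda>_. 1::nat" N] by simp
    also have "\<dots> \<le> (\<Sum>y\<in>N ` A. l + 1)"
    proof (intro sum_mono)
      fix y
      have "card {x \<in> A. N x = y} \<le> card {x::'a. x ^ (l + 1) = y}"
        by (intro card_mono) (auto simp: N_def)
      then show "card {x \<in> A. N x = y} \<le> l + 1"
        using card_power_eq_le[of "l + 1" y] by simp
    qed
    finally show ?thesis
      by (simp add: mult.commute)
  qed
  then have "l - 1 \<le> card (N ` A)"
    by (simp only: mult_le_cancel1)
  ultimately have "N ` A = T"
    by (intro card_seteq) auto
  moreover have "b \<in> T"
    using assms by (simp add: T_iff)
  ultimately obtain a where "b = N a"
    by blast
  then show ?thesis
    unfolding N_def by (intro exI[of _ a]) simp
qed

subsection \<open>Orthogonality and dimension\<close>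

lemma subspace_orthogonal: "vec.subspace {x. \<forall>b\<in>B. h x b = 0}"
  by (auto simp: vec.subspace_def h_add_left h_scale_left)

lemma orthogonal_span:
  assumes "\<And>b. b \<in> B \<Longrightarrow> h x b = 0" "y \<in> vec.span B"
  shows "h x y = 0"
proof -
  have "vec.subspace {y. h x y = 0}"
    by (auto simp: vec.subspace_def h_add_right h_scale_right)
  then have "vec.span B \<subseteq> {y. h x y = 0}"
    using assms(1) by (intro vec.span_minimal) auto
  then show ?thesis
    using assms(2) by auto
qed

lemma isotropic_span:
  assumes "\<And>x y. \<lbrakk>x \<in> B; y \<in> B\<rbrakk> \<Longrightarrow> h x y = 0"
  shows "isotropic_subspace h (vec.span B)"
proof -
  have "h x y = 0" if "x \<in> B" "y \<in> vec.span B" for x y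
    using orthogonal_span assms that by blast
  then have "h x y = 0" if "x \<in> vec.span B" "y \<in> vec.span B" for x y
    using orthogonal_span[of B y x] h_eq_0_commute that by blast
  then show ?thesis
    unfolding isotropic_subspace_def by auto
qed

text \<open>The orthogonality condition is one linear equation: if it fails at some \<open>p\<close>
  in \<open>S\<close>, then \<open>S\<close> is spanned by \<open>p\<close> and the
  solutions.\<close>

lemma dim_orthogonal_vector:
  assumes "vec.subspace S"
  shows "vec.dim S \<le> vec.dim {x \<in> S. h x b = 0} + 1"
proof (cases "\<exists>p\<in>S. h p b \<noteq> 0")
  case True
  then obtain p where p: "p \<in> S" "h p b \<noteq> 0"
    by blast
  have "S \<subseteq> vec.span (insert p {x \<in> S. h x b = 0})"
  proof
    fix x assume x: "x \<in> S"
    have "x - (h x b / h p b) *s p \<in> {x \<in> S. h x b = 0}"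
      using x p assms by (simp add: h_diff_left h_scale_left vec.subspace_diff vec.subspace_scale)
    then have "x - (h x b / h p b) *s p \<in> vec.span {x \<in> S. h x b = 0}"
      by (rule vec.span_base)
    then show "x \<in> vec.span (insert p {x \<in> S. h x b = 0})"
      by (auto simp: vec.span_insert)
  qed
  then have "vec.dim S \<le> vec.dim (insert p {x \<in> S. h x b = 0})"
    by (rule vec.dim_mono)
  then show ?thesis
    using vec.dim_insert[of p "{x \<in> S. h x b = 0}"] by (simp split: if_splits)
next
  case False
  then have "{x \<in> S. h x b = 0} = S"
    by auto
  then show ?thesis
    by simp
qed

lemma dim_orthogonal:
  assumes "vec.subspace S" "finite B"
  shows "vec.dim S \<le> vec.dim {x \<in> S. \<forall>b\<in>B. h x b = 0} + card B"
  using assms(2)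
proof (induction B rule: finite_induct)
  case (insert b B)
  have "{x \<in> S. \<forall>b\<in>B. h x b = 0} = S \<inter> {x. \<forall>b\<in>B. h x b = 0}"
    by auto
  then have "vec.subspace {x \<in> S. \<forall>b\<in>B. h x b = 0}"
    using assms(1) subspace_orthogonal by (simp add: vec.subspace_inter)
  note dim_orthogonal_vector[OF this, of b]
  moreover have "{x \<in> {x \<in> S. \<forall>b\<in>B. h x b = 0}. h x b = 0} = {x \<in> S. \<forall>b\<in>insert b B. h x b = 0}"
    by auto
  ultimately show ?case
    using insert by simp
qed simp

text \<open>Extend a basis of \<open>U\<close> to a basis of the space. A vector of \<open>U\<close>
  orthogonal to the added basis vectors is orthogonal to everything, hence zero, so \<open>U\<close>
  has no larger dimension than the number of added vectors.\<close>

lemma dim_isotropic_le: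
  assumes "isotropic_subspace h U"
  shows "2 * vec.dim U \<le> CARD('n)"
proof -
  have U: "vec.subspace U" "\<And>x y. \<lbrakk>x \<in> U; y \<in> U\<rbrakk> \<Longrightarrow> h x y = 0"
    using assms by (auto simp: isotropic_subspace_def)
  obtain B where B: "finite B" "B \<subseteq> U" "vec.independent B" "vec.span B = U" "card B = vec.dim U"
    using vec.basis_subspace_exists[OF U(1)] .
  obtain B' where B': "B \<subseteq> B'" "B' \<subseteq> UNIV" "vec.independent B'" "UNIV \<subseteq> vec.span B'"
    using vec.maximal_independent_subset_extend[OF subset_UNIV B(3)] .
  have "card B' = CARD('n)"
    using vec.basis_card_eq_dim[of B' UNIV] B' by (simp add: card_cart_basis)
  then have "card (B' - B) = CARD('n) - vec.dim U"
    using B B' by (simp add: card_Diff_subset)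
  moreover have "{x \<in> U. \<forall>b\<in>B' - B. h x b = 0} \<subseteq> {0}"
  proof
    fix x assume x: "x \<in> {x \<in> U. \<forall>b\<in>B' - B. h x b = 0}"
    then have "h x b = 0" if "b \<in> B'" for b
      using that U(2)[of x b] B(2) x by (cases "b \<in> B") auto
    then have "x = 0"
      using orthogonal_span[of B' x] B'(4) by (intro eq_0_if_orthogonal) auto
    then show "x \<in> {0}"
      by simp
  qed
  then have "vec.dim {x \<in> U. \<forall>b\<in>B' - B. h x b = 0} = 0"
    by simp
  moreover have "vec.dim U \<le> CARD('n)"
    by (rule dim_subset_UNIV_cart_gen)
  ultimately show ?thesis
    using dim_orthogonal[OF U(1) finite, of "B' - B"] by linarith
qed

subsection \<open>Orthonormal bases of degenerate forms\<close>

text \<open>If \<open>B v v\<close> vanished on \<open>W\<close>, polarisation would give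
  \<open>B x y = - B y x\<close> on \<open>W\<close>. Replacing \<open>x\<close> by
  \<open>a *s x\<close> with \<open>a ^ l\<close> different from \<open>a\<close> then forces
  \<open>B x y = 0\<close>.\<close>

lemma exists_nonisotropic:
  fixes B :: "'a^'n \<Rightarrow> 'a^'n \<Rightarrow> 'a"
  assumes W: "vec.subspace W"
    and add: "\<And>x y v. B (x + y) v = B x v + B y v"
    and scale: "\<And>c x v. B (c *s x) v = c * B x v"
    and flip: "\<And>x y. \<lbrakk>x \<in> W; y \<in> W\<rbrakk> \<Longrightarrow> B y x = B x y ^ l"
    and nonzero: "x \<in> W" "y \<in> W" "B x y \<noteq> 0"
  shows "\<exists>v\<in>W. B v v \<noteq> 0"
proof (rule ccontr)
  assume "\<not> ?thesis"
  then have zero: "B v v = 0" if "v \<in> W" for v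
    using that by blast
  have skew: "B x' y + B y x' = 0" if "x' \<in> W" for x'
  proof -
    have "x' + y \<in> W"
      using W nonzero that by (simp add: vec.subspace_add)
    \<comment> \<open>Additivity in the second argument is not assumed; it is obtained by flipping,
      which brings in the powers \<open>l\<close>.\<close>
    have "0 = B x' (x' + y) + B y (x' + y)"
      using zero[OF \<open>x' + y \<in> W\<close>] by (simp add: add)
    also have "\<dots> = (B x' x' + B y x') ^ l + (B x' y + B y y) ^ l"
      using flip[OF \<open>x' + y \<in> W\<close>] nonzero that by (simp add: add)
    also have "\<dots> = B x' y + B y x'"
      using zero nonzero that flip[of x' y] flip[of y x'] by simp
    finally show ?thesis
      by simp
  qed
  obtain a :: 'a where a: "a ^ l \<noteq> a"
    using exists_not_fixed by blast
  have ax: "a *s x \<in> W"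
    using W nonzero by (simp add: vec.subspace_scale)
  have "B y (a *s x) = a ^ l * B y x"
    using flip[OF ax, of y] flip[of x y] nonzero by (simp add: scale power_mult_distrib)
  then have "a * B x y + a ^ l * B y x = 0"
    using skew[OF ax] by (simp add: scale)
  moreover have "B y x = - B x y"
    using minus_unique[OF skew[OF nonzero(1)]] by simp
  ultimately have "(a - a ^ l) * B x y = 0"
    by (simp add: algebra_simps)
  then show False
    using a nonzero by simp
qed

text \<open>Gram--Schmidt by induction on the dimension: split off vectors of norm one until the
  form vanishes, then take any basis of what is left. The number \<open>k\<close> is the rank.
  Hermitean symmetry is assumed on \<open>W\<close> alone, which is how
  \<open>proj_form_flip\<close> supplies it.\<close>

lemma exists_orthonormal_basis:
  fixes B :: "'a^'n \<Rightarrow> 'a^'n \<Rightarrow> 'a"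
  assumes W: "vec.subspace W"
    and add: "\<And>x y v. B (x + y) v = B x v + B y v"
    and scale: "\<And>c x v. B (c *s x) v = c * B x v"
    and flip: "\<And>x y. \<lbrakk>x \<in> W; y \<in> W\<rbrakk> \<Longrightarrow> B y x = B x y ^ l"
  shows "\<exists>(p :: nat \<Rightarrow> 'a^'n) k. k \<le> vec.dim W \<and> p ` {..<vec.dim W} \<subseteq> W
    \<and> W \<subseteq> vec.span (p ` {..<vec.dim W})
    \<and> (\<forall>i<vec.dim W. \<forall>j<vec.dim W. B (p i) (p j) = (if i = j \<and> i < k then 1 else 0))"
  using W flip
proof (induction "vec.dim W" arbitrary: W)
  case 0
  then have "W \<subseteq> {0}"
    by simp
  then show ?case
    unfolding "0.hyps"[symmetric] by simp
next
  case (Suc n W)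
  note W = Suc.prems(1) and flip = Suc.prems(2)
  show ?case
  proof (cases "\<exists>x\<in>W. \<exists>y\<in>W. B x y \<noteq> 0")
    case False
    obtain C where C: "finite C" "C \<subseteq> W" "vec.independent C" "vec.span C = W" "card C = vec.dim W"
      using vec.basis_subspace_exists[OF W] .
    obtain p where "bij_betw p {0..<card C} C"
      using ex_bij_betw_nat_finite[OF C(1)] by blast
    then have image: "p ` {..<vec.dim W} = C"
      using C(5) by (simp add: bij_betw_def atLeast0LessThan)
    then have "p i \<in> W" if "i < vec.dim W" for i
      using C(2) that by auto
    then have "\<forall>i<vec.dim W. \<forall>j<vec.dim W. B (p i) (p j) = 0"
      using False by blast
    then show ?thesis
      using C(2,4) by (intro exI[of _ p] exI[of _ 0]) (simp add: image)
  next
    case True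
    then obtain v where v: "v \<in> W" "B v v \<noteq> 0"
      using exists_nonisotropic[OF W add scale flip] by blast
    \<comment> \<open>The value \<open>B v v\<close> is fixed by the Frobenius map, so its inverse
      is a norm \<open>a * a ^ l\<close>, and scaling \<open>v\<close> by \<open>a\<close> produces
      norm one.\<close>
    have "(1 / B v v) ^ l = 1 / B v v"
      using flip[OF v(1) v(1)] by (simp add: power_one_over)
    then obtain a where a: "a * a ^ l = 1 / B v v"
      using norm_surj[of "1 / B v v"] v(2) by auto
    define p0 where "p0 = a *s v"
    have p0: "p0 \<in> W"
      unfolding p0_def using W v by (simp add: vec.subspace_scale)
    have "B p0 p0 = a * B p0 v ^ l"
      using flip[OF p0 v(1)] by (simp add: p0_def scale)
    also have "\<dots> = a * a ^ l * B v v ^ l"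
      by (simp add: p0_def scale power_mult_distrib)
    also have "B v v ^ l = B v v"
      using flip[OF v(1) v(1)] by simp
    finally have norm1: "B p0 p0 = 1"
      using a v(2) by simp
    define W' where "W' = {y \<in> W. B y p0 = 0}"
    have zero: "B 0 y = 0" for y
      using scale[of 0 0 y] by simp
    have W': "vec.subspace W'"
      using W unfolding W'_def vec.subspace_def by (auto simp: add scale zero)
    have "p0 \<notin> W'"
      using norm1 by (simp add: W'_def)
    have "W \<subseteq> vec.span (insert p0 W')"
    proof
      fix x assume x: "x \<in> W"
      have "x - B x p0 *s p0 \<in> W'"
        using x p0 W norm1 add[of "x - B x p0 *s p0" "B x p0 *s p0" p0]
        by (simp add: W'_def scale vec.subspace_diff vec.subspace_scale)
      then have "x - B x p0 *s p0 \<in> vec.span W'"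
        by (rule vec.span_base)
      then show "x \<in> vec.span (insert p0 W')"
        by (auto simp: vec.span_insert)
    qed
    moreover have "vec.span (insert p0 W') \<subseteq> W"
      using p0 W by (intro vec.span_minimal) (auto simp: W'_def)
    ultimately have span_W: "vec.span (insert p0 W') = W"
      by auto
    then have "vec.dim W = vec.dim (insert p0 W')"
      by (metis vec.dim_span)
    also have "\<dots> = vec.dim W' + 1"
      using \<open>p0 \<notin> W'\<close> W' by (simp add: vec.dim_insert vec.span_eq_iff[THEN iffD2])
    finally have n: "n = vec.dim W'"
      using Suc.hyps(2) by simp
    have sub: "W' \<subseteq> W"
      by (auto simp: W'_def)
    have "\<exists>(p :: nat \<Rightarrow> 'a^'n) k. k \<le> vec.dim W' \<and> p ` {..<vec.dim W'} \<subseteq> W'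
      \<and> W' \<subseteq> vec.span (p ` {..<vec.dim W'})
      \<and> (\<forall>i<vec.dim W'. \<forall>j<vec.dim W'. B (p i) (p j) = (if i = j \<and> i < k then 1 else 0))"
      using Suc.hyps(1)[OF n W'] flip sub by blast
    then obtain p k where pk: "k \<le> n" "p ` {..<n} \<subseteq> W'" "W' \<subseteq> vec.span (p ` {..<n})"
      "\<And>i j. \<lbrakk>i < n; j < n\<rbrakk> \<Longrightarrow> B (p i) (p j) = (if i = j \<and> i < k then 1 else 0)"
      unfolding n[symmetric] by blast
    \<comment> \<open>The new vector goes to position \<open>0\<close>, so that the vectors of norm
      one precede those of the radical.\<close>
    define p' where "p' = case_nat p0 p"
    have p'_image: "p' ` {..<Suc n} = insert p0 (p ` {..<n})"
      by (auto simp: p'_def lessThan_Suc_eq_insert_0 image_image)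
    have "vec.span (insert p0 W') \<subseteq> vec.span (insert p0 (p ` {..<n}))"
      using pk(3) vec.span_mono[of "p ` {..<n}" "insert p0 (p ` {..<n})"]
      by (intro vec.span_minimal) (auto intro: vec.span_base)
    moreover have "B (p' i) (p' j) = (if i = j \<and> i < Suc k then 1 else 0)"
      if "i < Suc n" "j < Suc n" for i j
    proof -
      have orth: "B (p m) p0 = 0" "B p0 (p m) = 0" if "m < n" for m
      proof -
        have "p m \<in> W'"
          using pk(2) that by auto
        then show "B (p m) p0 = 0"
          by (simp add: W'_def)
        then show "B p0 (p m) = 0"
          using flip[of "p m" p0] \<open>p m \<in> W'\<close> sub p0 l_ge_2 by (auto simp: power_0_left)
      qed
      show ?thesis
        using that norm1 orth pk(4) by (cases i; cases j) (auto simp: p'_def)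
    qed
    moreover have "p' ` {..<Suc n} \<subseteq> W"
      using pk(2) sub p0 by (auto simp: p'_image)
    ultimately have "Suc k \<le> Suc n \<and> p' ` {..<Suc n} \<subseteq> W \<and> W \<subseteq> vec.span (p' ` {..<Suc n})
      \<and> (\<forall>i<Suc n. \<forall>j<Suc n. B (p' i) (p' j) = (if i = j \<and> i < Suc k then 1 else 0))"
      using pk(1) span_W by (simp add: p'_image)
    then show ?thesis
      unfolding Suc.hyps(2)[symmetric] by (intro exI)
  qed
qed

end

section \<open>Hermitean dual polar graphs and Hermitean forms graphs\<close>

locale hermitean_polar_space = hermitean_space h l
  for h :: "('a::{field,finite})^'n \<Rightarrow> 'a^'n \<Rightarrow> 'a" and l :: nat +
  fixes d :: nat
  assumes d_pos: "d \<ge> 1" and dimension: "CARD('n) = 2 * d"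
begin

abbreviation "\<Delta> \<equiv> dual_polar_graph d h"

section \<open>Neighbours and distances in the dual polar graph\<close>

lemma dim_isotropic_le_d: "isotropic_subspace h U \<Longrightarrow> vec.dim U \<le> d"
  using dim_isotropic_le[of U] dimension by simp

lemma isotropic_maximal:
  assumes "isotropic_subspace h U" "vec.dim U = d"
  shows "maximal_isotropic h U"
  unfolding maximal_isotropic_def
proof (intro conjI allI impI)
  fix W assume W: "isotropic_subspace h W \<and> U \<subseteq> W"
  then show "W = U"
    using dim_isotropic_le_d[of W] assms vec.subspace_dim_equal[of U W]
    by (auto simp: isotropic_subspace_def)
qed fact

lemma verts_iff: "U \<in> verts \<Delta> \<longleftrightarrow> isotropic_subspace h U \<and> vec.dim U = d"
  using isotropic_maximal by (auto simp: dual_polar_graph_def maximal_isotropic_def)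

lemma edges_iff:
  "(U, W) \<in> edges \<Delta> \<longleftrightarrow> U \<in> verts \<Delta> \<and> W \<in> verts \<Delta> \<and> vec.dim (U \<inter> W) = d - 1"
  by (auto simp: dual_polar_graph_def)

lemma vertsD:
  assumes "U \<in> verts \<Delta>"
  shows "vec.subspace U" "\<And>x y. \<lbrakk>x \<in> U; y \<in> U\<rbrakk> \<Longrightarrow> h x y = 0" "vec.dim U = d"
  using assms by (auto simp: verts_iff isotropic_subspace_def)

text \<open>For isotropic \<open>p\<close> outside a vertex \<open>T\<close>, this is the neighbour
  of \<open>T\<close> spanned by \<open>p\<close> and the vectors of \<open>T\<close> orthogonal to
  \<open>p\<close>. It is one step closer to every vertex \<open>S\<close> that contains
  \<open>p\<close>.\<close>

definition step :: "'a^'n \<Rightarrow> ('a^'n) set \<Rightarrow> ('a^'n) set" where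
  "step p T = vec.span (insert p {u \<in> T. h u p = 0})"

lemma p_in_step: "p \<in> step p T"
  unfolding step_def by (rule vec.span_base) simp

text \<open>The vectors of \<open>T\<close> orthogonal to \<open>p\<close> have dimension at least
  \<open>d - 1\<close>. Adjoining \<open>p\<close> keeps the space isotropic, so the bound
  \<open>d\<close> makes both dimensions exact.\<close>

lemma step_in_verts:
  assumes T: "T \<in> verts \<Delta>" and p: "h p p = 0" "p \<notin> T"
  shows "step p T \<in> verts \<Delta>" "(step p T, T) \<in> edges \<Delta>"
proof -
  note T' = vertsD[OF T]
  have iso: "isotropic_subspace h (step p T)"
    unfolding step_def using p T'(2) h_eq_0_commute by (intro isotropic_span) auto
  have "vec.subspace {u \<in> T. h u p = 0}"
    using T'(1) unfolding vec.subspace_def by (auto simp: h_add_left h_scale_left)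
  then have "p \<notin> vec.span {u \<in> T. h u p = 0}"
    using p(2) by (subst vec.span_eq_iff[THEN iffD2]) auto
  then have "vec.dim (step p T) = vec.dim {u \<in> T. h u p = 0} + 1"
    by (simp add: step_def vec.dim_insert)
  moreover have "d \<le> vec.dim {u \<in> T. h u p = 0} + 1"
    using dim_orthogonal_vector[OF T'(1), of p] T'(3) by simp
  ultimately have dim: "vec.dim (step p T) = d" "vec.dim {u \<in> T. h u p = 0} = d - 1"
    using dim_isotropic_le_d[OF iso] by linarith+
  then show step: "step p T \<in> verts \<Delta>"
    using iso by (simp add: verts_iff)
  have "{u \<in> T. h u p = 0} \<subseteq> step p T \<inter> T"
    unfolding step_def by (auto intro: vec.span_base)
  from vec.dim_subset[OF this] have "d - 1 \<le> vec.dim (step p T \<inter> T)"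
    unfolding dim(2) .
  moreover have "vec.dim (step p T \<inter> T) \<noteq> d"
  proof
    assume "vec.dim (step p T \<inter> T) = d"
    then have "step p T \<inter> T = step p T"
      using vertsD[OF step] T'(1) dim(1)
      by (intro vec.subspace_dim_equal vec.subspace_inter) auto
    then show False
      using p_in_step p(2) by blast
  qed
  moreover have "vec.dim (step p T \<inter> T) \<le> d"
    using vec.dim_subset[of "step p T \<inter> T" T] T'(3) by simp
  ultimately have "vec.dim (step p T \<inter> T) = d - 1"
    by linarith
  then show "(step p T, T) \<in> edges \<Delta>"
    using step T by (simp add: edges_iff)
qed

text \<open>As \<open>S\<close> is isotropic, all of \<open>S \<inter> T\<close> is orthogonal to
  \<open>p\<close> and survives in \<open>step p T\<close>, which contains \<open>p\<close> in
  addition.\<close>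

lemma dim_Int_step:
  assumes S: "S \<in> verts \<Delta>" and T: "T \<in> verts \<Delta>" and p: "p \<in> S" "p \<notin> T"
  shows "vec.dim (S \<inter> step p T) \<ge> vec.dim (S \<inter> T) + 1"
proof -
  have p0: "h p p = 0"
    using vertsD(2)[OF S p(1) p(1)] .
  have "S \<inter> T \<subseteq> step p T"
    unfolding step_def using vertsD(2)[OF S _ p(1)] by (auto intro!: vec.span_base)
  then have "vec.dim (insert p (S \<inter> T)) \<le> vec.dim (S \<inter> step p T)"
    using p p_in_step by (intro vec.dim_subset) auto
  moreover have "vec.span (S \<inter> T) = S \<inter> T"
    using vertsD(1)[OF S] vertsD(1)[OF T] by (simp add: vec.subspace_inter vec.span_eq_iff)
  ultimately show ?thesis
    using p by (simp add: vec.dim_insert)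
qed

lemma dim_Int_le:
  assumes "U \<in> verts \<Delta>"
  shows "vec.dim (S \<inter> U) \<le> d"
  using vec.dim_subset[of "S \<inter> U" U] vertsD(3)[OF assms] by simp

lemma verts_eq_if_dim_Int:
  assumes "S \<in> verts \<Delta>" "T \<in> verts \<Delta>" "d \<le> vec.dim (S \<inter> T)"
  shows "S = T"
proof -
  note sub = vertsD(1)[OF assms(1)] vertsD(1)[OF assms(2)]
  have "S \<inter> T = S"
    using sub vertsD(3)[OF assms(1)] assms(3)
    by (intro vec.subspace_dim_equal vec.subspace_inter) simp_all
  moreover have "S \<inter> T = T"
    using sub vertsD(3)[OF assms(2)] assms(3)
    by (intro vec.subspace_dim_equal vec.subspace_inter) simp_all
  ultimately show ?thesis
    by simp
qed

lemma walk_exists: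
  assumes "S \<in> verts \<Delta>" "T \<in> verts \<Delta>"
  shows "\<exists>n \<le> d - vec.dim (S \<inter> T). (S, T) \<in> edges \<Delta> ^^ n"
  using assms
proof (induction "d - vec.dim (S \<inter> T)" arbitrary: T rule: less_induct)
  case less
  show ?case
  proof (cases "S \<subseteq> T")
    case True
    then have "S = T"
      using less.prems vertsD(3)[OF less.prems(1)] by (intro verts_eq_if_dim_Int) (auto simp: Int_absorb2)
    then show ?thesis
      by (intro exI[of _ 0]) simp
  next
    case False
    then obtain p where p: "p \<in> S" "p \<notin> T"
      by blast
    note step = step_in_verts[OF less.prems(2) vertsD(2)[OF less.prems(1) p(1) p(1)] p(2)]
    have "vec.dim (S \<inter> T) + 1 \<le> vec.dim (S \<inter> step p T)"
      by (rule dim_Int_step[OF less.prems p])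
    moreover have "vec.dim (S \<inter> step p T) \<le> d"
      by (rule dim_Int_le[OF step(1)])
    ultimately have less_dim: "d - vec.dim (S \<inter> step p T) < d - vec.dim (S \<inter> T)"
      by linarith
    obtain n where n: "n \<le> d - vec.dim (S \<inter> step p T)" "(S, step p T) \<in> edges \<Delta> ^^ n"
      using less.hyps[OF less_dim less.prems(1) step(1)] by blast
    then have "Suc n \<le> d - vec.dim (S \<inter> T)"
      using less_dim by linarith
    then show ?thesis
      using n(2) step(2) by (intro exI[of _ "Suc n"]) auto
  qed
qed

text \<open>An edge from \<open>U\<close> to \<open>T\<close> lowers the dimension of the
  intersection with \<open>S\<close> by at most one: inside \<open>U\<close>, the hyperplane
  \<open>U \<inter> T\<close> cuts \<open>S \<inter> U\<close> in codimension at most one.\<close>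

lemma walk_length:
  assumes "(S, T) \<in> edges \<Delta> ^^ n" "S \<in> verts \<Delta>"
  shows "d \<le> vec.dim (S \<inter> T) + n"
  using assms(1)
proof (induction n arbitrary: T)
  case 0
  then show ?case
    using vertsD(3)[OF assms(2)] by simp
next
  case (Suc n)
  then obtain U where U: "(S, U) \<in> edges \<Delta> ^^ n" "(U, T) \<in> edges \<Delta>"
    by auto
  then have UT: "U \<in> verts \<Delta>" "T \<in> verts \<Delta>" "vec.dim (U \<inter> T) = d - 1"
    by (simp_all add: edges_iff)
  note sub = vertsD(1)[OF assms(2)] vertsD(1)[OF UT(1)] vertsD(1)[OF UT(2)]
  have "vec.dim {x + y |x y. x \<in> S \<inter> U \<and> y \<in> U \<inter> T} + vec.dim ((S \<inter> U) \<inter> (U \<inter> T))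
      = vec.dim (S \<inter> U) + vec.dim (U \<inter> T)"
    using sub by (intro vec.dim_sums_Int vec.subspace_inter)
  moreover have "vec.dim {x + y |x y. x \<in> S \<inter> U \<and> y \<in> U \<inter> T} \<le> vec.dim U"
    using sub by (intro vec.dim_subset) (auto simp: vec.subspace_add)
  moreover have "vec.dim ((S \<inter> U) \<inter> (U \<inter> T)) \<le> vec.dim (S \<inter> T)"
    by (intro vec.dim_subset) auto
  ultimately show ?case
    using Suc.IH[OF U(1)] vertsD(3)[OF UT(1)] UT(3) d_pos by linarith
qed

lemma gdist_eq:
  assumes "S \<in> verts \<Delta>" "T \<in> verts \<Delta>"
  shows "gdist \<Delta> S T = d - vec.dim (S \<inter> T)"
  unfolding gdist_def
proof (rule Least_equality)
  obtain n where "n \<le> d - vec.dim (S \<inter> T)" "(S, T) \<in> edges \<Delta> ^^ n"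
    using walk_exists[OF assms] by blast
  moreover from this have "d - vec.dim (S \<inter> T) \<le> n"
    using walk_length[of S T n] assms by linarith
  ultimately show "(S, T) \<in> edges \<Delta> ^^ (d - vec.dim (S \<inter> T))"
    by simp
next
  fix n assume "(S, T) \<in> edges \<Delta> ^^ n"
  then show "d - vec.dim (S \<inter> T) \<le> n"
    using walk_length[of S T n] assms by linarith
qed

subsection \<open>Opposite maximal isotropic subspaces\<close>

lemma opposite_decomposition:
  assumes "U \<in> verts \<Delta>" "z \<in> verts \<Delta>" "U \<inter> z = {0}"
  obtains u \<zeta> where "u \<in> U" "\<zeta> \<in> z" "x = u + \<zeta>"
proof -
  let ?S = "{u + \<zeta> |u \<zeta>. u \<in> U \<and> \<zeta> \<in> z}"
  note sub = vertsD(1)[OF assms(1)] vertsD(1)[OF assms(2)]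
  have "vec.dim ?S = CARD('n)"
    using vec.dim_sums_Int[OF sub] assms dimension vertsD(3) by simp
  moreover have "vec.subspace ?S"
    using sub by (rule vec.subspace_sums)
  ultimately have "?S = UNIV"
    by (intro vec.subspace_dim_equal) (auto simp: card_cart_basis)
  then show ?thesis
    using that by blast
qed

lemma eq_0_if_orthogonal_opposite:
  assumes "U \<in> verts \<Delta>" "z \<in> verts \<Delta>" "U \<inter> z = {0}"
    and "\<And>u. u \<in> U \<Longrightarrow> h x u = 0" "\<And>\<zeta>. \<zeta> \<in> z \<Longrightarrow> h x \<zeta> = 0"
  shows "x = 0"
proof (rule eq_0_if_orthogonal)
  fix y
  obtain u \<zeta> where "u \<in> U" "\<zeta> \<in> z" "y = u + \<zeta>"
    using opposite_decomposition[OF assms(1-3)] .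
  then show "h x y = 0"
    using assms(4,5) by (simp add: h_add_right)
qed

text \<open>The projection to \<open>U\<close> along \<open>z\<close>, well defined for opposite
  \<open>U\<close> and \<open>z\<close>, whose direct sum is the whole space.\<close>

definition proj :: "('a^'n) set \<Rightarrow> ('a^'n) set \<Rightarrow> 'a^'n \<Rightarrow> 'a^'n" where
  "proj U z x = (THE u. u \<in> U \<and> x - u \<in> z)"

context
  fixes U z :: "('a^'n) set"
  assumes U: "U \<in> verts \<Delta>" and z: "z \<in> verts \<Delta>" and opp: "U \<inter> z = {0}"
begin

lemma proj_eqI:
  assumes "u \<in> U" "x - u \<in> z"
  shows "proj U z x = u"
  unfolding proj_def
proof (rule the_equality)
  fix v assume v: "v \<in> U \<and> x - v \<in> z"
  then have "v - u \<in> U"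
    using assms vertsD(1)[OF U] by (simp add: vec.subspace_diff)
  moreover have "v - u \<in> z"
    using vec.subspace_diff[OF vertsD(1)[OF z] assms(2), of "x - v"] v by simp
  ultimately have "v - u \<in> U \<inter> z"
    by blast
  then show "v = u"
    using opp by simp
qed (use assms in simp)

lemma proj_props: "proj U z x \<in> U" "x - proj U z x \<in> z"
proof -
  obtain u \<zeta> where "u \<in> U" "\<zeta> \<in> z" "x = u + \<zeta>"
    using opposite_decomposition[OF U z opp] .
  moreover from this have "proj U z x = u"
    by (intro proj_eqI) auto
  ultimately show "proj U z x \<in> U" "x - proj U z x \<in> z"
    by simp_all
qed

lemma proj_add: "proj U z (x + y) = proj U z x + proj U z y"
proof (rule proj_eqI)
  have "(x - proj U z x) + (y - proj U z y) \<in> z"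
    using vertsD(1)[OF z] proj_props by (intro vec.subspace_add)
  then show "x + y - (proj U z x + proj U z y) \<in> z"
    by (simp add: algebra_simps)
qed (use vertsD(1)[OF U] proj_props in \<open>auto intro: vec.subspace_add\<close>)

lemma proj_scale: "proj U z (c *s x) = c *s proj U z x"
proof (rule proj_eqI)
  have "c *s (x - proj U z x) \<in> z"
    using vertsD(1)[OF z] proj_props by (intro vec.subspace_scale)
  then show "c *s x - c *s proj U z x \<in> z"
    by (simp add: vector_ssub_ldistrib)
qed (use vertsD(1)[OF U] proj_props in \<open>auto intro: vec.subspace_scale\<close>)

text \<open>Expand \<open>0 = h y x\<close> along the decomposition into \<open>U\<close> and
  \<open>z\<close>: the parts within \<open>U\<close> and within \<open>z\<close> vanish, and the
  two mixed terms cancel.\<close>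

lemma h_proj_skew:
  assumes W: "W \<in> verts \<Delta>" and xy: "x \<in> W" "y \<in> W"
  shows "h (proj U z y) x = - (h (proj U z x) y ^ l)"
proof -
  define u v where "u = proj U z x" and "v = proj U z y"
  have uv: "u \<in> U" "v \<in> U" "x - u \<in> z" "y - v \<in> z"
    using proj_props by (auto simp: u_def v_def)
  have "0 = h y x"
    using vertsD(2)[OF W] xy by simp
  also have "\<dots> = h v x + h (y - v) x"
    by (simp flip: h_add_left)
  also have "h (y - v) x = h (y - v) u + h (y - v) (x - u)"
    by (simp flip: h_add_right)
  also have "h (y - v) (x - u) = 0"
    using vertsD(2)[OF z uv(4,3)] .
  also have "h (y - v) u = h u (y - v) ^ l"
    by (rule h_flip)
  also have "h u (y - v) = h u y"
    using vertsD(2)[OF U uv(1,2)] h_add_right[of u "y - v" v] by simp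
  finally have "h v x + h u y ^ l = 0"
    by simp
  then show ?thesis
    unfolding u_def v_def by (simp add: eq_neg_iff_add_eq_0)
qed

text \<open>\<open>W\<close> is opposite to \<open>z\<close> as well, so every \<open>u\<close> in
  \<open>U\<close> is the projection of some \<open>w\<close> in \<open>W\<close>. Hence for
  \<open>y\<close> in \<open>W\<close> the difference \<open>y - proj U z y\<close> is orthogonal to
  \<open>U\<close>, as well as to \<open>z\<close>, and vanishes.\<close>

lemma proj_form_eq_0_imp_eq:
  assumes W: "W \<in> verts \<Delta>" "W \<inter> z = {0}"
    and zero: "\<And>x y. \<lbrakk>x \<in> W; y \<in> W\<rbrakk> \<Longrightarrow> h (proj U z x) y = 0"
  shows "W = U"
proof -
  have "W \<subseteq> U"
  proof
    fix y assume y: "y \<in> W"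
    have "h (y - proj U z y) u = 0" if u: "u \<in> U" for u
    proof -
      obtain w \<zeta> where w: "w \<in> W" "\<zeta> \<in> z" "u = w + \<zeta>"
        using opposite_decomposition[OF W(1) z W(2)] .
      then have "proj U z w = u"
        using u vertsD(1)[OF z] by (intro proj_eqI) (auto simp: vec.subspace_neg)
      then have "h u y = 0"
        using zero[OF w(1) y] by simp
      moreover have "h u (proj U z y) = 0"
        using vertsD(2)[OF U u] proj_props by blast
      ultimately have "h u (y - proj U z y) = 0"
        using h_add_right[of u "y - proj U z y" "proj U z y"] by simp
      then show ?thesis
        by (simp add: h_eq_0_commute)
    qed
    moreover have "h (y - proj U z y) \<zeta> = 0" if "\<zeta> \<in> z" for \<zeta>
      using vertsD(2)[OF z _ that] proj_props by blast
    ultimately have "y - proj U z y = 0"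
      by (rule eq_0_if_orthogonal_opposite[OF U z opp])
    then show "y \<in> U"
      using proj_props(1)[of y] by simp
  qed
  then show ?thesis
    using vertsD[OF W(1)] vertsD[OF U] by (intro vec.subspace_dim_equal) auto
qed

text \<open>A subspace \<open>W\<close> opposite to \<open>z\<close> is the graph of a linear map \<open>U \<rightarrow> z\<close>. This is the form on \<open>U\<close>
  encoding that map, pulled back to \<open>W\<close>; a scalar \<open>c\<close> with \<open>c ^ l = - c\<close> makes it Hermitean
  instead of skew-Hermitean.\<close>

definition proj_form :: "'a \<Rightarrow> 'a^'n \<Rightarrow> 'a^'n \<Rightarrow> 'a" where
  "proj_form c x y = h (proj U z x) y / c"

lemma proj_form_add: "proj_form c (x + y) v = proj_form c x v + proj_form c y v"
  and proj_form_scale: "proj_form c (a *s x) v = a * proj_form c x v"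
  by (simp_all add: proj_form_def proj_add proj_scale h_add_left h_scale_left add_divide_distrib)

lemma proj_form_flip:
  assumes "c ^ l = - c" "W \<in> verts \<Delta>" "x \<in> W" "y \<in> W"
  shows "proj_form c y x = proj_form c x y ^ l"
  using h_proj_skew[OF assms(2-4)] assms(1) by (simp add: proj_form_def power_divide)

lemma exists_proj_nonisotropic:
  assumes W: "W \<in> verts \<Delta>" "W \<inter> z = {0}" "W \<noteq> U"
  shows "\<exists>p\<in>W. h (proj U z p) p \<noteq> 0"
proof -
  obtain c :: 'a where c: "c \<noteq> 0" "c ^ l = - c"
    using exists_skew by blast
  obtain x y where "x \<in> W" "y \<in> W" "h (proj U z x) y \<noteq> 0"
    using proj_form_eq_0_imp_eq[OF W(1,2)] W(3) by blast
  then have "\<exists>v\<in>W. proj_form c v v \<noteq> 0"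
    using c by (intro exists_nonisotropic[OF vertsD(1)[OF W(1)] proj_form_add proj_form_scale
        proj_form_flip[OF c(2) W(1)]]) (auto simp: proj_form_def)
  then show ?thesis
    by (auto simp: proj_form_def)
qed

end

text \<open>Write \<open>x\<close> in \<open>step p U\<close> as \<open>k *s p\<close> plus a vector
  \<open>u\<close> of \<open>U\<close> orthogonal to \<open>p\<close>. If \<open>x\<close> lies in
  \<open>z\<close>, then \<open>k *s p\<close> projects to \<open>- u\<close>, so
  \<open>k * h (proj U z p) p = 0\<close> and \<open>k = 0\<close>.\<close>

lemma step_opposite:
  assumes U: "U \<in> verts \<Delta>" and z: "z \<in> verts \<Delta>" and opp: "U \<inter> z = {0}"
    and p: "h (proj U z p) p \<noteq> 0"
  shows "step p U \<inter> z = {0}"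
proof -
  have "x = 0" if x: "x \<in> step p U" "x \<in> z" for x
  proof -
    obtain k where "x - k *s p \<in> vec.span {u \<in> U. h u p = 0}"
      using x(1) unfolding step_def vec.span_insert by blast
    moreover have "vec.subspace {u \<in> U. h u p = 0}"
      using vertsD(1)[OF U] unfolding vec.subspace_def by (auto simp: h_add_left h_scale_left)
    ultimately have u: "x - k *s p \<in> U" "h (x - k *s p) p = 0"
      by (simp_all add: vec.span_eq_iff[THEN iffD2])
    have "k *s p - - (x - k *s p) \<in> z"
      using x(2) by simp
    then have "proj U z (k *s p) = - (x - k *s p)"
      using u(1) vertsD(1)[OF U] by (intro proj_eqI[OF U z opp] vec.subspace_neg)
    then have "k * h (proj U z p) p = - h (x - k *s p) p"
      using h_diff_left[of 0 "x - k *s p" p] by (simp add: proj_scale[OF U z opp] flip: h_scale_left)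
    then have "k = 0"
      using u(2) p by simp
    then have "x \<in> U \<inter> z"
      using u(1) x(2) by simp
    then show ?thesis
      using opp by simp
  qed
  moreover have "0 \<in> step p U" "0 \<in> z"
    using vertsD(1)[OF z] by (auto simp: step_def vec.subspace_0 vec.span_zero)
  ultimately show ?thesis
    by blast
qed

subsection \<open>Distances in the Hermitean forms graph\<close>

context
  fixes z assumes z: "z \<in> verts \<Delta>"
begin

abbreviation "\<Gamma> \<equiv> hermitean_forms_graph d h z"

lemma forms_verts_iff: "U \<in> verts \<Gamma> \<longleftrightarrow> U \<in> verts \<Delta> \<and> U \<inter> z = {0}"
proof -
  have "gdist \<Delta> z U = d \<longleftrightarrow> U \<inter> z = {0}" if U: "U \<in> verts \<Delta>"
  proof -
    have "gdist \<Delta> z U = d \<longleftrightarrow> vec.dim (U \<inter> z) = 0"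
      using gdist_eq[OF z U] dim_Int_le[OF U, of z] d_pos unfolding Int_commute[of U z] by linarith
    moreover have "0 \<in> U \<inter> z"
      using vertsD(1)[OF U] vertsD(1)[OF z] by (simp add: vec.subspace_0)
    ultimately show ?thesis
      by auto
  qed
  then show ?thesis
    by (auto simp: hermitean_forms_graph_def induced_subgraph_def)
qed

lemma forms_edges_iff: "(U, W) \<in> edges \<Gamma> \<longleftrightarrow> (U, W) \<in> edges \<Delta> \<and> U \<in> verts \<Gamma> \<and> W \<in> verts \<Gamma>"
  by (auto simp: hermitean_forms_graph_def induced_subgraph_def edges_iff)

text \<open>The walk is built as in the dual polar graph, but \<open>p\<close> is taken from
  \<open>exists_proj_nonisotropic\<close> so that every vertex on the way stays opposite to
  \<open>z\<close>.\<close>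

lemma forms_walk_exists:
  assumes "S \<in> verts \<Gamma>" "T \<in> verts \<Gamma>"
  shows "\<exists>n \<le> d - vec.dim (S \<inter> T). (S, T) \<in> edges \<Gamma> ^^ n"
  using assms
proof (induction "d - vec.dim (S \<inter> T)" arbitrary: T rule: less_induct)
  case less
  show ?case
  proof (cases "S = T")
    case True
    then show ?thesis
      by (intro exI[of _ 0]) simp
  next
    case False
    have S: "S \<in> verts \<Delta>" "S \<inter> z = {0}" and T: "T \<in> verts \<Delta>" "T \<inter> z = {0}"
      using less.prems by (auto simp: forms_verts_iff)
    obtain p where p: "p \<in> S" "h (proj T z p) p \<noteq> 0"
      using exists_proj_nonisotropic[OF T(1) z T(2) S False] by blast
    have p0: "h p p = 0"
      using vertsD(2)[OF S(1) p(1) p(1)] .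
    \<comment> \<open>A vector of \<open>T\<close> is its own projection, and \<open>p\<close> is
      isotropic.\<close>
    have "p \<notin> T"
    proof
      assume "p \<in> T"
      then have "proj T z p = p"
        using vertsD(1)[OF z] by (intro proj_eqI[OF T(1) z T(2)]) (auto simp: vec.subspace_0)
      then show False
        using p(2) p0 by simp
    qed
    note step = step_in_verts[OF T(1) p0 this]
    have step_verts: "step p T \<in> verts \<Gamma>"
      using step(1) step_opposite[OF T(1) z T(2) p(2)] by (simp add: forms_verts_iff)
    have "vec.dim (S \<inter> T) + 1 \<le> vec.dim (S \<inter> step p T)"
      by (rule dim_Int_step[OF S(1) T(1) p(1) \<open>p \<notin> T\<close>])
    moreover have "vec.dim (S \<inter> step p T) \<le> d"
      by (rule dim_Int_le[OF step(1)])
    ultimately have less_dim: "d - vec.dim (S \<inter> step p T) < d - vec.dim (S \<inter> T)"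
      by linarith
    obtain n where n: "n \<le> d - vec.dim (S \<inter> step p T)" "(S, step p T) \<in> edges \<Gamma> ^^ n"
      using less.hyps[OF less_dim less.prems(1) step_verts] by blast
    moreover have "(step p T, T) \<in> edges \<Gamma>"
      using step(2) step_verts less.prems(2) by (simp add: forms_edges_iff)
    moreover have "Suc n \<le> d - vec.dim (S \<inter> T)"
      using n(1) less_dim by linarith
    ultimately show ?thesis
      by (intro exI[of _ "Suc n"]) auto
  qed
qed

text \<open>The lower bound is inherited from the dual polar graph, of which this is a
  subgraph.\<close>

lemma forms_gdist_eq:
  assumes "S \<in> verts \<Gamma>" "T \<in> verts \<Gamma>"
  shows "gdist \<Gamma> S T = d - vec.dim (S \<inter> T)"
proof -
  have lower: "d - vec.dim (S \<inter> T) \<le> n" if "(S, T) \<in> edges \<Gamma> ^^ n" for n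
  proof -
    have "edges \<Gamma> \<subseteq> edges \<Delta>"
      by (auto simp: forms_edges_iff)
    then have "edges \<Gamma> ^^ n \<subseteq> edges \<Delta> ^^ n"
      by (induction n) auto
    then have "(S, T) \<in> edges \<Delta> ^^ n"
      using that by blast
    then show ?thesis
      using walk_length[of S T n] assms(1) by (simp add: forms_verts_iff)
  qed
  obtain n where "n \<le> d - vec.dim (S \<inter> T)" "(S, T) \<in> edges \<Gamma> ^^ n"
    using forms_walk_exists[OF assms] by blast
  with lower[of n] have "(S, T) \<in> edges \<Gamma> ^^ (d - vec.dim (S \<inter> T))"
    by simp
  then show ?thesis
    unfolding gdist_def using lower by (rule Least_equality)
qed

end

end

context hermitean_polar_space
begin

subsection \<open>Hyperbolic frames\<close>

text \<open>A hyperbolic basis. Completeness is expressed by orthogonality, so that equality of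
  vectors can be tested on coordinates.\<close>

definition frame :: "(nat \<Rightarrow> 'a^'n) \<Rightarrow> (nat \<Rightarrow> 'a^'n) \<Rightarrow> bool" where
  "frame u e \<longleftrightarrow>
     (\<forall>i<d. \<forall>j<d. h (u i) (u j) = 0 \<and> h (e i) (e j) = 0 \<and> h (u i) (e j) = (if i = j then 1 else 0)) \<and>
     (\<forall>x. (\<forall>j<d. h x (u j) = 0 \<and> h x (e j) = 0) \<longrightarrow> x = 0)"

lemma frameD:
  assumes "frame u e" "i < d" "j < d"
  shows "h (u i) (u j) = 0" "h (e i) (e j) = 0"
    "h (u i) (e j) = (if i = j then 1 else 0)" "h (e j) (u i) = (if i = j then 1 else 0)"
proof -
  show *: "h (u i) (u j) = 0" "h (e i) (e j) = 0" "h (u i) (e j) = (if i = j then 1 else 0)"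
    using assms unfolding frame_def by blast+
  have "h (e j) (u i) = h (u i) (e j) ^ l"
    by (rule h_flip)
  also have "\<dots> = (if i = j then 1 else 0)"
    using *(3) l_ge_2 by (simp add: power_0_left)
  finally show "h (e j) (u i) = (if i = j then 1 else 0)" .
qed

lemma frame_eqI:
  assumes "frame u e" "\<And>j. j < d \<Longrightarrow> h x (u j) = h y (u j)" "\<And>j. j < d \<Longrightarrow> h x (e j) = h y (e j)"
  shows "x = y"
proof -
  have "\<forall>j<d. h (x - y) (u j) = 0 \<and> h (x - y) (e j) = 0"
    using assms(2,3) by (simp add: h_diff_left)
  then have "x - y = 0"
    using assms(1) unfolding frame_def by blast
  then show ?thesis
    by simp
qed

text \<open>In a frame, the coefficient of \<open>x\<close> at \<open>u i\<close> is
  \<open>h x (e i)\<close> and the one at \<open>e i\<close> is \<open>h x (u i)\<close>. This is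
  the linear map that carries one frame to the other.\<close>

definition frame_map ::
    "(nat \<Rightarrow> 'a^'n) \<Rightarrow> (nat \<Rightarrow> 'a^'n) \<Rightarrow> (nat \<Rightarrow> 'a^'n) \<Rightarrow> (nat \<Rightarrow> 'a^'n) \<Rightarrow> 'a^'n \<Rightarrow> 'a^'n" where
  "frame_map u e u' e' x = (\<Sum>i<d. h x (e i) *s u' i) + (\<Sum>i<d. h x (u i) *s e' i)"

lemma frame_map_coords:
  assumes "frame u' e'" "j < d"
  shows "h (frame_map u e u' e' x) (u' j) = h x (u j)"
    and "h (frame_map u e u' e' x) (e' j) = h x (e j)"
proof -
  have "h (frame_map u e u' e' x) (u' j)
      = (\<Sum>i<d. 0) + (\<Sum>i<d. if i = j then h x (u j) else 0)"
    unfolding frame_map_def h_add_left h_sum_left h_scale_left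
    by (intro arg_cong2[where f = "(+)"] sum.cong refl) (auto simp: frameD[OF assms(1)] assms(2))
  then show "h (frame_map u e u' e' x) (u' j) = h x (u j)"
    using assms(2) by simp
  have "h (frame_map u e u' e' x) (e' j)
      = (\<Sum>i<d. if i = j then h x (e j) else 0) + (\<Sum>i<d. 0)"
    unfolding frame_map_def h_add_left h_sum_left h_scale_left
    by (intro arg_cong2[where f = "(+)"] sum.cong refl) (auto simp: frameD[OF assms(1)] assms(2))
  then show "h (frame_map u e u' e' x) (e' j) = h x (e j)"
    using assms(2) by simp
qed

lemma frame_expansion: "frame u e \<Longrightarrow> frame_map u e u e x = x"
  using frame_map_coords[of u e _ u e x] by (intro frame_eqI[of u e]) auto

lemma frame_map_inverse:
  assumes "frame u e" "frame u' e'"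
  shows "frame_map u' e' u e (frame_map u e u' e' x) = x"
  using frame_map_coords[OF assms(2), of _ u e x]
    frame_map_coords[OF assms(1), of _ u' e' "frame_map u e u' e' x"]
  by (intro frame_eqI[OF assms(1)]) simp_all

lemma frame_map_isometry:
  assumes "frame u e" "frame u' e'"
  shows "h (frame_map u e u' e' x) (frame_map u e u' e' y) = h x y"
proof -
  have "h (frame_map u e u' e' x) (frame_map u e u' e' y)
      = (\<Sum>i<d. h y (e i) ^ l * h x (u i)) + (\<Sum>i<d. h y (u i) ^ l * h x (e i))"
    using frame_map_coords[OF assms(2), of _ u e x]
    unfolding frame_map_def[of u e u' e' y] h_add_right h_sum_right h_scale_right by simp
  also have "\<dots> = h x (frame_map u e u e y)"
    unfolding frame_map_def h_add_right h_sum_right h_scale_right by simp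
  finally show ?thesis
    by (simp add: frame_expansion[OF assms(1)])
qed

lemma frame_map_linear: "Vector_Spaces.linear (*s) (*s) (frame_map u e u' e')"
  unfolding Vector_Spaces.linear_iff
  by (simp add: vec.vector_space_axioms frame_map_def h_add_left h_scale_left vec.scale_left_distrib
      sum.distrib vec.scale_right_distrib vec.scale_sum_right add_ac)

lemma frame_map_inj:
  assumes "frame u e" "frame u' e'"
  shows "inj (frame_map u e u' e')"
  by (rule inj_on_inverseI) (rule frame_map_inverse[OF assms])

lemma dim_frame_map_image:
  assumes "frame u e" "frame u' e'"
  shows "vec.dim (frame_map u e u' e' ` S) = vec.dim S"
  using frame_map_linear inj_on_subset[OF frame_map_inj[OF assms]]
  by (intro vec.dim_image_eq) auto

lemma frame_map_image_verts:
  assumes "frame u e" "frame u' e'" "U \<in> verts \<Delta>"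
  shows "frame_map u e u' e' ` U \<in> verts \<Delta>"
proof -
  have "vec.subspace (frame_map u e u' e' ` U)"
    using vec.linear_subspace_image[OF frame_map_linear vertsD(1)[OF assms(3)]] .
  then show ?thesis
    using vertsD[OF assms(3)] dim_frame_map_image[OF assms(1,2)] frame_map_isometry[OF assms(1,2)]
    by (auto simp: verts_iff isotropic_subspace_def)
qed

text \<open>The subspace with coordinates \<open>c, k\<close> is spanned by the \<open>u\<^sub>i - c e\<^sub>i\<close> with \<open>i < k\<close> and
  the \<open>u\<^sub>i\<close> with \<open>k \<le> i < d\<close>.\<close>

definition frame_subspace :: "(nat \<Rightarrow> 'a^'n) \<Rightarrow> (nat \<Rightarrow> 'a^'n) \<Rightarrow> 'a \<Rightarrow> nat \<Rightarrow> ('a^'n) set" where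
  "frame_subspace u e c k = {x. \<forall>j<d. h x (u j) = (if j < k then - c else 0) * h x (e j)}"

lemma frame_map_in_frame_subspace:
  assumes "frame u' e'" "x \<in> frame_subspace u e c k"
  shows "frame_map u e u' e' x \<in> frame_subspace u' e' c k"
  using assms(2) frame_map_coords[OF assms(1)] by (simp add: frame_subspace_def)

lemma frame_map_frame_subspace:
  assumes "frame u e" "frame u' e'"
  shows "frame_map u e u' e' ` frame_subspace u e c k = frame_subspace u' e' c k"
proof
  show "frame_subspace u' e' c k \<subseteq> frame_map u e u' e' ` frame_subspace u e c k"
  proof
    fix y assume "y \<in> frame_subspace u' e' c k"
    then have "frame_map u' e' u e y \<in> frame_subspace u e c k"
      by (rule frame_map_in_frame_subspace[OF assms(1)])
    then show "y \<in> frame_map u e u' e' ` frame_subspace u e c k"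
      using frame_map_inverse[OF assms(2,1), of y] by (metis imageI)
  qed
qed (use frame_map_in_frame_subspace[OF assms(2)] in blast)

text \<open>For a frame this is the span of the \<open>e j\<close>, which takes the place of
  \<open>z\<close>.\<close>

definition frame_pole :: "(nat \<Rightarrow> 'a^'n) \<Rightarrow> ('a^'n) set" where
  "frame_pole e = {x. \<forall>j<d. h x (e j) = 0}"

lemma frame_map_in_frame_pole:
  assumes "frame u' e'" "x \<in> frame_pole e"
  shows "frame_map u e u' e' x \<in> frame_pole e'"
  using assms(2) frame_map_coords[OF assms(1)] by (simp add: frame_pole_def)

lemma frame_map_frame_pole:
  assumes "frame u e" "frame u' e'"
  shows "frame_map u e u' e' ` frame_pole e = frame_pole e'"
proof
  show "frame_pole e' \<subseteq> frame_map u e u' e' ` frame_pole e"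
  proof
    fix y assume "y \<in> frame_pole e'"
    then have "frame_map u' e' u e y \<in> frame_pole e"
      by (rule frame_map_in_frame_pole[OF assms(1)])
    then show "y \<in> frame_map u e u' e' ` frame_pole e"
      using frame_map_inverse[OF assms(2,1), of y] by (metis imageI)
  qed
qed (use frame_map_in_frame_pole[OF assms(2)] in blast)

text \<open>As \<open>c\<close> is nonzero, the intersection is cut out of the first subspace by the
  \<open>k\<close> equations \<open>h x (e j) = 0\<close> with \<open>j < k\<close>; conversely it
  lies in the span of the \<open>d - k\<close> remaining \<open>u j\<close>.\<close>

lemma dim_Int_frame_subspace:
  assumes f: "frame u e" and c: "c \<noteq> 0" and k: "k \<le> d"
    and U: "frame_subspace u e c 0 \<in> verts \<Delta>"
  shows "vec.dim (frame_subspace u e c 0 \<inter> frame_subspace u e c k) = d - k"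
proof -
  let ?S = "frame_subspace u e c 0 \<inter> frame_subspace u e c k"
  have "?S = {x \<in> frame_subspace u e c 0. \<forall>b\<in>e ` {..<k}. h x b = 0}"
    using c k by (auto simp: frame_subspace_def)
  then have "d \<le> vec.dim ?S + card (e ` {..<k})"
    using dim_orthogonal[OF vertsD(1)[OF U], of "e ` {..<k}"] vertsD(3)[OF U] by simp
  moreover have "card (e ` {..<k}) \<le> k"
    using card_image_le[of "{..<k}" e] by simp
  moreover have "vec.dim ?S \<le> card (u ` {k..<d})"
  proof (rule vec.dim_le_card)
    show "?S \<subseteq> vec.span (u ` {k..<d})"
    proof
      fix x assume x: "x \<in> ?S"
      then have coords: "h x (u j) = 0" "j < k \<Longrightarrow> h x (e j) = 0" if "j < d" for j
        using that c by (auto simp: frame_subspace_def)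
      have "x = (\<Sum>i<d. h x (e i) *s u i) + (\<Sum>i<d. h x (u i) *s e i)"
        using frame_expansion[OF f, of x] unfolding frame_map_def by simp
      also have "(\<Sum>i<d. h x (u i) *s e i) = 0"
        using coords(1) by simp
      finally have "x = (\<Sum>i<d. h x (e i) *s u i)"
        by simp
      moreover have "(\<Sum>i<d. h x (e i) *s u i) \<in> vec.span (u ` {k..<d})"
      proof (rule vec.span_sum)
        fix i assume i: "i \<in> {..<d}"
        show "h x (e i) *s u i \<in> vec.span (u ` {k..<d})"
        proof (cases "i < k")
          case True
          then show ?thesis
            using coords(2)[of i] i by (simp add: vec.span_zero)
        next
          case False
          then show ?thesis
            using i by (intro vec.span_scale vec.span_base) auto
        qed
      qed
      ultimately show "x \<in> vec.span (u ` {k..<d})"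
        by metis
    qed
  qed simp
  moreover have "card (u ` {k..<d}) \<le> d - k"
    using card_image_le[of "{k..<d}" u] by simp
  ultimately show ?thesis
    using k by linarith
qed

text \<open>The at most \<open>d - 1\<close> conditions with \<open>i\<close> different from
  \<open>j\<close> leave a nonzero vector of \<open>z\<close>. It is not orthogonal to
  \<open>u j\<close>, since otherwise it would be orthogonal to \<open>U\<close> and
  \<open>z\<close>, so it can be rescaled.\<close>

lemma exists_dual_vector:
  assumes U: "U \<in> verts \<Delta>" and z: "z \<in> verts \<Delta>" and opp: "U \<inter> z = {0}"
    and u: "u ` {..<d} \<subseteq> U" "U \<subseteq> vec.span (u ` {..<d})" and j: "j < d"
  shows "\<exists>e\<in>z. \<forall>i<d. h (u i) e = (if i = j then 1 else 0)"
proof -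
  let ?B = "u ` ({..<d} - {j})"
  have "d \<le> vec.dim {x \<in> z. \<forall>b\<in>?B. h x b = 0} + card ?B"
    using dim_orthogonal[OF vertsD(1)[OF z], of ?B] vertsD(3)[OF z] by simp
  moreover have "card ?B \<le> d - 1"
    using card_image_le[of "{..<d} - {j}" u] j by simp
  ultimately have "vec.dim {x \<in> z. \<forall>b\<in>?B. h x b = 0} > 0"
    using d_pos by linarith
  then have "\<not> {x \<in> z. \<forall>b\<in>?B. h x b = 0} \<subseteq> {0}"
    unfolding vec.dim_eq_0[symmetric] by linarith
  then obtain v where v: "v \<in> z" "\<And>i. \<lbrakk>i < d; i \<noteq> j\<rbrakk> \<Longrightarrow> h v (u i) = 0" "v \<noteq> 0"
    by auto
  have vj: "h v (u j) \<noteq> 0"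
  proof
    assume "h v (u j) = 0"
    then have "h v b = 0" if "b \<in> u ` {..<d}" for b
      using v(2) that by (metis imageE lessThan_iff)
    then have "h v x = 0" if "x \<in> U" for x
      using orthogonal_span[of "u ` {..<d}" v x] u(2) that by blast
    then have "v = 0"
      using vertsD(2)[OF z v(1)] by (intro eq_0_if_orthogonal_opposite[OF U z opp])
    then show False
      using v(3) by simp
  qed
  define e where "e = (1 / h v (u j)) *s v"
  have "h e (u i) = (if i = j then 1 else 0)" if "i < d" for i
    using v(2)[OF that] vj by (simp add: e_def h_scale_left)
  then have "h (u i) e = (if i = j then 1 else 0)" if "i < d" for i
    using h_flip[of "u i" e] that l_ge_2 by (simp add: power_0_left)
  moreover have "e \<in> z"
    unfolding e_def using v(1) vertsD(1)[OF z] by (intro vec.subspace_scale)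
  ultimately show ?thesis
    by blast
qed

text \<open>Normal form of a triple \<open>z, U, W\<close>: take an orthonormal basis of
  \<open>W\<close> for \<open>proj_form\<close>, let the \<open>u i\<close> be its projections to
  \<open>U\<close>, and the \<open>e i\<close> the dual basis in \<open>z\<close>.\<close>

lemma exists_frame:
  assumes U: "U \<in> verts \<Delta>" "U \<inter> z = {0}" and W: "W \<in> verts \<Delta>" "W \<inter> z = {0}"
    and z: "z \<in> verts \<Delta>" and c: "c \<noteq> 0" "c ^ l = - c"
  shows "\<exists>u e k. k \<le> d \<and> frame u e \<and> z = frame_pole e
    \<and> U = frame_subspace u e c 0 \<and> W = frame_subspace u e c k"
proof -
  note opp = U(1) z U(2)
  let ?\<pi> = "proj U z"
  have "\<exists>p k. k \<le> d \<and> p ` {..<d} \<subseteq> W \<and> W \<subseteq> vec.span (p ` {..<d})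
    \<and> (\<forall>i<d. \<forall>j<d. proj_form U z c (p i) (p j) = (if i = j \<and> i < k then 1 else 0))"
    using exists_orthonormal_basis[OF vertsD(1)[OF W(1)] proj_form_add[OF opp]
        proj_form_scale[OF opp] proj_form_flip[OF opp c(2) W(1)]]
    unfolding vertsD(3)[OF W(1)] .
  then obtain p k where k: "k \<le> d" and p: "p ` {..<d} \<subseteq> W" "W \<subseteq> vec.span (p ` {..<d})"
    and form: "\<And>i j. \<lbrakk>i < d; j < d\<rbrakk> \<Longrightarrow>
      proj_form U z c (p i) (p j) = (if i = j \<and> i < k then 1 else 0)"
    by blast
  define u where "u i = ?\<pi> (p i)" for i
  have u_U: "u i \<in> U" for i
    unfolding u_def by (rule proj_props[OF opp])
  have span_u: "U \<subseteq> vec.span (u ` {..<d})"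
  proof
    fix x assume x: "x \<in> U"
    obtain w \<zeta> where w: "w \<in> W" "\<zeta> \<in> z" "x = w + \<zeta>"
      using opposite_decomposition[OF W(1) z W(2)] .
    then have "?\<pi> w = x"
      using x vertsD(1)[OF z] by (intro proj_eqI[OF opp]) (auto simp: vec.subspace_neg)
    moreover have "vec.subspace {y. ?\<pi> y \<in> vec.span (u ` {..<d})}"
      using proj_scale[OF opp, of 0 0]
      by (auto simp: vec.subspace_def proj_add[OF opp] proj_scale[OF opp] vec.span_add vec.span_scale
          vec.span_zero)
    then have "vec.span (p ` {..<d}) \<subseteq> {y. ?\<pi> y \<in> vec.span (u ` {..<d})}"
      by (intro vec.span_minimal) (auto simp: u_def intro!: vec.span_base)
    ultimately show "x \<in> vec.span (u ` {..<d})"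
      using w(1) p(2) by blast
  qed
  have "\<forall>j. \<exists>e. j < d \<longrightarrow> e \<in> z \<and> (\<forall>i<d. h (u i) e = (if i = j then 1 else 0))"
    using exists_dual_vector[OF opp _ span_u] u_U by (metis image_subsetI)
  then obtain e where e: "\<And>j. j < d \<Longrightarrow> e j \<in> z"
    "\<And>i j. \<lbrakk>i < d; j < d\<rbrakk> \<Longrightarrow> h (u i) (e j) = (if i = j then 1 else 0)"
    by metis
  have orth_u: "x = 0" if "x \<in> z" "\<And>j. j < d \<Longrightarrow> h x (u j) = 0" for x
  proof (rule eq_0_if_orthogonal_opposite[OF opp])
    fix y assume "y \<in> U"
    then show "h x y = 0"
      using orthogonal_span[of "u ` {..<d}" x y] that(2) span_u by blast
  qed (use vertsD(2)[OF z that(1)] in blast)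
  have orth_e: "x = 0" if x: "x \<in> U" "\<And>j. j < d \<Longrightarrow> h x (e j) = 0" for x
  proof -
    \<comment> \<open>\<open>g\<close> fixes every \<open>u j\<close>, hence all of
      \<open>U\<close>; so a vector of \<open>U\<close> is recovered from its products with the
      \<open>e j\<close>.\<close>
    define g where "g x = (\<Sum>i<d. h x (e i) *s u i)" for x
    have "g 0 = 0" "g (x + y) = g x + g y" "g (c *s x) = c *s g x" for x y c
      by (simp_all add: g_def h_add_left h_scale_left vec.scale_left_distrib sum.distrib
          vec.scale_sum_right)
    then have "vec.subspace {x. x = g x}"
      by (auto simp: vec.subspace_def)
    moreover have "u j = g (u j)" if j: "j < d" for j
    proof -
      have "g (u j) = (\<Sum>i<d. if j = i then u i else 0)"
        unfolding g_def using e(2)[OF j] by (intro sum.cong) auto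
      then show ?thesis
        using j by simp
    qed
    ultimately have "vec.span (u ` {..<d}) \<subseteq> {x. x = g x}"
      by (intro vec.span_minimal) auto
    then have "x = g x"
      using span_u x(1) by blast
    then show ?thesis
      using x(2) by (simp add: g_def)
  qed
  have split: "?\<pi> x \<in> U" "x - ?\<pi> x \<in> z" for x
    by (rule proj_props[OF opp])+
  have h_u: "h x (u j) = h (x - ?\<pi> x) (u j)" for x j
    using vertsD(2)[OF U(1) split(1) u_U] by (simp add: h_diff_left)
  have h_e: "h x (e j) = h (?\<pi> x) (e j)" if "j < d" for x j
    using vertsD(2)[OF z split(2) e(1)[OF that], of x] by (simp add: h_diff_left)
  have frame: "frame u e"
    unfolding frame_def
  proof (intro conjI allI impI)
    fix x assume x: "\<forall>j<d. h x (u j) = 0 \<and> h x (e j) = 0"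
    have "x - ?\<pi> x = 0"
      using x by (intro orth_u split) (simp flip: h_u)
    moreover have "?\<pi> x = 0"
      using x by (intro orth_e split) (simp flip: h_e)
    ultimately show "x = 0"
      by simp
  qed (use vertsD(2)[OF U(1) u_U u_U] vertsD(2)[OF z] e in auto)
  have "U = frame_subspace u e c 0"
  proof
    show "frame_subspace u e c 0 \<subseteq> U"
    proof
      fix x assume "x \<in> frame_subspace u e c 0"
      then have "x - ?\<pi> x = 0"
        by (intro orth_u split) (simp add: frame_subspace_def flip: h_u)
      then show "x \<in> U"
        using split(1)[of x] by simp
    qed
  qed (use vertsD(2)[OF U(1)] u_U in \<open>auto simp: frame_subspace_def\<close>)
  moreover have "z = frame_pole e"
  proof
    show "frame_pole e \<subseteq> z"
    proof
      fix x assume "x \<in> frame_pole e"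
      then have "?\<pi> x = 0"
        by (intro orth_e split) (simp add: frame_pole_def flip: h_e)
      then show "x \<in> z"
        using split(2)[of x] by simp
    qed
  qed (use vertsD(2)[OF z] e(1) in \<open>auto simp: frame_pole_def\<close>)
  moreover have "W = frame_subspace u e c k"
  proof
    have sub: "vec.subspace (frame_subspace u e c k)"
      by (auto simp: vec.subspace_def frame_subspace_def h_add_left h_scale_left distrib_left)
    have "p i \<in> frame_subspace u e c k" if i: "i < d" for i
      unfolding frame_subspace_def
    proof (intro CollectI allI impI)
      fix j assume j: "j < d"
      \<comment> \<open>The form on \<open>W\<close> prescribes these products up to the factor
        \<open>c\<close>. Exchanging the arguments turns \<open>c\<close> into
        \<open>c ^ l = - c\<close>, the sign in \<open>frame_subspace\<close>.\<close>
      have "h (u j) (p i) = c * (if j = i \<and> j < k then 1 else 0)"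
        using form[OF j i] c(1) by (simp add: proj_form_def[OF opp] u_def field_simps split: if_splits)
      then have "h (p i) (u j) = (c * (if j = i \<and> j < k then 1 else 0)) ^ l"
        using h_flip[of "p i" "u j"] by simp
      moreover have "h (p i) (e j) = (if i = j then 1 else 0)"
        using h_e[OF j, of "p i"] e(2)[OF i j] by (simp add: u_def)
      ultimately show "h (p i) (u j) = (if j < k then - c else 0) * h (p i) (e j)"
        using c(2) l_ge_2 by (auto simp: power_0_left)
    qed
    then have "vec.span (p ` {..<d}) \<subseteq> frame_subspace u e c k"
      using sub by (intro vec.span_minimal) auto
    then show W_sub: "W \<subseteq> frame_subspace u e c k"
      using p(2) by blast
    show "frame_subspace u e c k \<subseteq> W"
    proof
      fix x assume x: "x \<in> frame_subspace u e c k"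
      \<comment> \<open>It remains to remove \<open>\<zeta>\<close>. It lies in \<open>z\<close> and
        in the frame subspace, so its products with the \<open>e j\<close>, and with them those with
        the \<open>u j\<close>, vanish.\<close>
      obtain w \<zeta> where w: "w \<in> W" "\<zeta> \<in> z" "x = w + \<zeta>"
        using opposite_decomposition[OF W(1) z W(2)] .
      have "x - w \<in> frame_subspace u e c k"
        using x w(1) W_sub sub by (auto intro: vec.subspace_diff)
      then have \<zeta>: "\<zeta> \<in> frame_subspace u e c k"
        using w(3) by simp
      have "\<zeta> = 0"
      proof (rule orth_u[OF w(2)])
        fix j assume j: "j < d"
        then show "h \<zeta> (u j) = 0"
          using \<zeta> vertsD(2)[OF z w(2) e(1)[OF j]] by (simp add: frame_subspace_def)
      qed
      then show "x \<in> W"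
        using w by simp
    qed
  qed
  ultimately show ?thesis
    using k frame by blast
qed

text \<open>The rank \<open>k\<close> in the normal form is determined by the dimension of
  \<open>U \<inter> W\<close>, which is \<open>d - k\<close>. So both triples have the same
  coordinates in their frames, and the frame map carries one to the other.\<close>

lemma exists_isometry:
  assumes z: "z \<in> verts \<Delta>"
    and UW: "U \<in> verts \<Delta>" "U \<inter> z = {0}" "W \<in> verts \<Delta>" "W \<inter> z = {0}"
    and UW': "U' \<in> verts \<Delta>" "U' \<inter> z = {0}" "W' \<in> verts \<Delta>" "W' \<inter> z = {0}"
    and dim: "vec.dim (U \<inter> W) = vec.dim (U' \<inter> W')"
  obtains g where "inj g" "\<And>S. vec.dim (g ` S) = vec.dim S" "\<And>S. S \<in> verts \<Delta> \<Longrightarrow> g ` S \<in> verts \<Delta>"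
    "g ` z = z" "g ` U = U'" "g ` W = W'"
proof -
  obtain c :: 'a where c: "c \<noteq> 0" "c ^ l = - c"
    using exists_skew by blast
  obtain u e k where f: "k \<le> d" "frame u e" "z = frame_pole e" "U = frame_subspace u e c 0"
    "W = frame_subspace u e c k"
    using exists_frame[OF UW z c] by blast
  obtain u' e' k' where f': "k' \<le> d" "frame u' e'" "z = frame_pole e'" "U' = frame_subspace u' e' c 0"
    "W' = frame_subspace u' e' c k'"
    using exists_frame[OF UW' z c] by blast
  have "k = k'"
    using dim_Int_frame_subspace[OF f(2) c(1) f(1)] dim_Int_frame_subspace[OF f'(2) c(1) f'(1)]
      UW(1) UW'(1) f f' dim by simp
  then show ?thesis
    using that[of "frame_map u e u' e'"] frame_map_inj dim_frame_map_image frame_map_image_verts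
      frame_map_frame_pole frame_map_frame_subspace f f' by metis
qed

subsection \<open>Distance-regularity of the Hermitean forms graph\<close>

text \<open>An isometry fixing \<open>z\<close> permutes opposites of \<open>z\<close> and preserves
  distances, so it injects one set into the other; equality follows by exchanging the pairs.\<close>

lemma card_forms_distances_le:
  fixes z
  defines "G \<equiv> hermitean_forms_graph d h z"
  assumes z: "z \<in> verts \<Delta>"
    and UW: "U \<in> verts G" "W \<in> verts G" and UW': "U' \<in> verts G" "W' \<in> verts G"
    and dist: "gdist G U W = gdist G U' W'"
  shows "card {S \<in> verts G. gdist G U S = i \<and> gdist G S W = j}
    \<le> card {S \<in> verts G. gdist G U' S = i \<and> gdist G S W' = j}"
proof -
  note verts_iff = forms_verts_iff[OF z, folded G_def]
  note gdist_eq = forms_gdist_eq[OF z, folded G_def]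
  have "vec.dim (U \<inter> W) = vec.dim (U' \<inter> W')"
    using dist gdist_eq[OF UW] gdist_eq[OF UW'] dim_Int_le[of W U] dim_Int_le[of W' U'] UW UW'
    by (simp add: verts_iff)
  then obtain g where g: "inj g" "\<And>S. vec.dim (g ` S) = vec.dim S"
    "\<And>S. S \<in> verts \<Delta> \<Longrightarrow> g ` S \<in> verts \<Delta>" "g ` z = z" "g ` U = U'" "g ` W = W'"
    using exists_isometry[OF z, of U W U' W'] UW UW' by (auto simp: verts_iff)
  have verts: "g ` S \<in> verts G" if S: "S \<in> verts G" for S
  proof -
    have "g ` S \<inter> z = g ` (S \<inter> z)"
      using image_Int[OF g(1), of S z] g(4) by simp
    moreover have "vec.dim (g ` (S \<inter> z)) = 0"
      using S by (simp only: g(2)) (simp add: verts_iff)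
    moreover have "0 \<in> g ` S" "0 \<in> z"
      using S g(3)[of S] z vertsD(1) by (auto simp: verts_iff vec.subspace_0)
    ultimately have "g ` S \<inter> z = {0}"
      using vec.dim_eq_0 by blast
    then show ?thesis
      using S g(3) by (simp add: verts_iff)
  qed
  have dist: "gdist G (g ` S) (g ` T) = gdist G S T" if "S \<in> verts G" "T \<in> verts G" for S T
    using that verts by (simp add: gdist_eq g(2) image_Int[OF g(1), symmetric])
  show ?thesis
  proof (rule card_inj_on_le)
    show "inj_on ((`) g) {S \<in> verts G. gdist G U S = i \<and> gdist G S W = j}"
      using g(1) by (auto simp: inj_on_def inj_image_eq_iff)
    show "(`) g ` {S \<in> verts G. gdist G U S = i \<and> gdist G S W = j}
      \<subseteq> {S \<in> verts G. gdist G U' S = i \<and> gdist G S W' = j}"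
      using verts dist UW g(5,6) by (auto simp flip: g(5,6))
  qed simp
qed

lemma distance_regular_forms:
  assumes z: "z \<in> verts \<Delta>"
  shows "\<exists>p. distance_regular (hermitean_forms_graph d h z) p"
proof -
  define G where "G = hermitean_forms_graph d h z"
  define n where "n U W i j = card {S \<in> verts G. gdist G U S = i \<and> gdist G S W = j}" for U W i j
  \<comment> \<open>The number is read off at a chosen pair at distance \<open>m\<close>; by
    \<open>n_eq\<close> the choice has no influence. If there is no such pair, the value is
    arbitrary.\<close>
  define p where "p i j m = n (fst (SOME P. fst P \<in> verts G \<and> snd P \<in> verts G \<and> gdist G (fst P) (snd P) = m))
     (snd (SOME P. fst P \<in> verts G \<and> snd P \<in> verts G \<and> gdist G (fst P) (snd P) = m)) i j" for i j m
  have n_eq: "n U W i j = n U' W' i j"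
    if "U \<in> verts G" "W \<in> verts G" "U' \<in> verts G" "W' \<in> verts G" "gdist G U W = gdist G U' W'"
    for U W U' W' i j
    unfolding n_def using that
    by (intro order_antisym card_forms_distances_le[OF z, folded G_def]) simp_all
  have "distance_regular G p"
  proof
    show "finite (verts G)"
      by (rule finite)
    show "edges G \<subseteq> verts G \<times> verts G"
      by (auto simp: G_def hermitean_forms_graph_def induced_subgraph_def dual_polar_graph_def)
    show "sym (edges G)"
      by (auto simp: G_def hermitean_forms_graph_def induced_subgraph_def dual_polar_graph_def
          sym_def Int_commute)
    show "\<exists>m. (U, W) \<in> edges G ^^ m" if "U \<in> verts G" "W \<in> verts G" for U W
      using forms_walk_exists[OF z] that unfolding G_def by blast
    show "card {S \<in> verts G. gdist G U S = i \<and> gdist G S W = j} = p i j (gdist G U W)"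
      if "U \<in> verts G" "W \<in> verts G" for U W i j
    proof -
      let ?P = "\<lambda>P. fst P \<in> verts G \<and> snd P \<in> verts G \<and> gdist G (fst P) (snd P) = gdist G U W"
      have "?P (U, W)"
        using that by simp
      then have "?P (SOME P. ?P P)"
        by (rule someI)
      then have "n U W i j = p i j (gdist G U W)"
        unfolding p_def using that by (intro n_eq) simp_all
      then show ?thesis
        by (simp add: n_def)
    qed
  qed
  then show ?thesis
    unfolding G_def by blast
qed

end

theorem mainTheorem13:
  fixes d l :: nat
    and h :: "('a::{field,finite})^'n \<Rightarrow> 'a^'n \<Rightarrow> 'a"
    and z :: "('a^'n) set"
    and E :: "nat \<Rightarrow> ('a^'n) set cmatrix"
  assumes "d \<ge> 3"
    and "primepow l"
    and "CARD('a) = l ^ 2"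
    and "CARD('n) = 2 * d"
    and "hermitean_form l h"
    and "nondegenerate h"
    and "z \<in> verts (dual_polar_graph d h)"
    and "standard_Q_ordering (hermitean_forms_graph d h z) (- of_nat l) E"
  shows "\<not> (\<exists>Y. nontrivial_descendent (hermitean_forms_graph d h z) E Y)"
proof -
  interpret hermitean_polar_space h l d
    using assms by unfold_locales auto
  obtain p where "distance_regular (hermitean_forms_graph d h z) p"
    using distance_regular_forms assms(7) by blast
  then show ?thesis
    using distance_regular.standard_ordering_no_nontrivial_descendent l_ge_2 assms(8) by blast
qed

end
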